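(* Let $\mathbb T$ be a time scale, $c,d\in\mathbb T$ with $c<d$, $A,B\in\mathbb R$, and let $\bar L:\mathbb T\times\mathbb R\times\mathbb R\to\mathbb R$, $(s,x,w)\mapsto\bar L(s,x,w)$, be of class $C^2$ in the second and third variables and ld-continuous in the first variable. If $\bar y_0$ is a weak local minimum of the variational problem $$\bar{\mathcal L}(h)=\int_c^d\bar L\big(s,h^\rho(s),h^\nabla(s)\big)\nabla s,\qquad h(c)=A,\ h(d)=B,$$ then the Euler–Lagrange equation $$\bar L_x\big(s,\bar y_0^\rho(s),\bar y_0^\nabla(s)\big)=(\bar L_w)^\nabla\big(s,\bar y_0^\rho(s),\bar y_0^\nabla(s)\big)\quad\text{for all }s\in[c,d]_\kappa$$ holds, where the right-hand side denotes the nabla derivative at $s$ of the function $p(s)=\bar L_w\big(s,\bar y_0^\rho(s),\bar y_0^\nabla(s)\big)$.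
   Context: A time scale is a nonempty closed subset $\mathbb T\subseteq\mathbb R$. Jump operators: $\sigma(t)=\inf\{s\in\mathbb T:s>t\}$, $\rho(t)=\sup\{s\in\mathbb T:s<t\}$, with $\inf\emptyset=\sup\mathbb T$, $\sup\emptyset=\inf\mathbb T$. A point $t$ is right-dense if $\sigma(t)=t$ and left-dense if $\rho(t)=t$. $\mathbb T_\kappa=\mathbb T\setminus[\inf\mathbb T,\sigma(\inf\mathbb T))$ if $\inf\mathbb T>-\infty$, and $\mathbb T_\kappa=\mathbb T$ otherwise. For $c<d$ in $\mathbb T$, $[c,d]$ denotes $\{t\in\mathbb T:c\le t\le d\}$, and $[c,d]_\kappa=[\sigma(c),d]$. For a function $h$, $h^\rho=h\circ\rho$. Nabla derivative: $f$ is nabla differentiable at $t\in\mathbb T_\kappa$ with $f^\nabla(t)=\beta$ if for every $\epsilon>0$ there is a neighborhood $U$ of $t$ such that $|f(\rho(t))-f(s)-\beta(\rho(t)-s)|\le\epsilon|\rho(t)-s|$ for all $s\in U$. A function is ld-continuous if it is continuous at left-dense points and has finite right-sided limits at all right-dense points. $C^1_{ld}$ is the set of functions $f:[c,d]\to\mathbb R$ such that $f^\nabla(t)$ exists for all $t\in[c,d]_\kappa$ and $f^\nabla$ is ld-continuous, with norm $\|f\|_{C^1_{ld}}=\max_{t\in[c,d]_\kappa}|f^\rho(t)|+\max_{t\in[c,d]_\kappa}|f^\nabla(t)|$. Nabla integral: $\int_c^df(s)\nabla s=F(d)-F(c)$, where $F$ is an antiderivative of $f$, i.e. $F^\nabla=f$.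 $\bar L_x$ and $\bar L_w$ are the partial derivatives of $\bar L$ with respect to its second and third variables. Weak local minimum: $\bar y_0(c)=A$, $\bar y_0(d)=B$, and there is $\delta>0$ such that $\bar{\mathcal L}(\bar y_0)\le\bar{\mathcal L}(y)$ for all $y\in C^1_{ld}$ with $y(c)=A$, $y(d)=B$ and $\|y-\bar y_0\|_{C^1_{ld}}\le\delta$.
   Formalization: ρ, ∇ and ld-continuity are taken in the time scale [c,d]; L_x and L_w are also assumed ld-continuous in s jointly with (x,w); if c is right-scattered, p(c) is undefined, so the equation is stated for some extension of p from [c,d]_κ to c. *)

theory Defs
  imports "HOL-Analysis.Analysis"
begin

section \<open>Nabla calculus on a time scale\<close>

definition time_scale :: "real set \<Rightarrow> bool" where
  "time_scale T \<longleftrightarrow> T \<noteq> {} \<and> closed T"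

text \<open>The conventions \<open>inf \<emptyset> = sup T\<close> and \<open>sup \<emptyset> = inf T\<close> are spelled out, because
  \<open>Inf {}\<close> and \<open>Sup {}\<close> are unspecified on the reals.\<close>

definition ts_sigma :: "real set \<Rightarrow> real \<Rightarrow> real" where
  "ts_sigma T t = (if \<exists>s\<in>T. t < s then Inf {s\<in>T. t < s} else Sup T)"

definition ts_rho :: "real set \<Rightarrow> real \<Rightarrow> real" where
  "ts_rho T t = (if \<exists>s\<in>T. s < t then Sup {s\<in>T. s < t} else Inf T)"

definition kappa :: "real set \<Rightarrow> real set" where
  "kappa T = (if bdd_below T then T - {Inf T ..< ts_sigma T (Inf T)} else T)"

definition has_nabla_derivative ::
    "real set \<Rightarrow> (real \<Rightarrow> real) \<Rightarrow> real \<Rightarrow> real \<Rightarrow> bool" where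
  "has_nabla_derivative T f \<beta> t \<longleftrightarrow>
     t \<in> kappa T \<and>
     (\<forall>\<epsilon>>0. \<exists>U. open U \<and> t \<in> U \<and>
        (\<forall>s\<in>U \<inter> T. \<bar>f (ts_rho T t) - f s - \<beta> * (ts_rho T t - s)\<bar> \<le> \<epsilon> * \<bar>ts_rho T t - s\<bar>))"

definition nabla_deriv :: "real set \<Rightarrow> (real \<Rightarrow> real) \<Rightarrow> real \<Rightarrow> real" where
  "nabla_deriv T f t = (THE \<beta>. has_nabla_derivative T f \<beta> t)"

text \<open>Ld-continuity of a function with domain \<open>D \<subseteq> T\<close>. Whether a point is left- or right-dense is
  decided in the time scale \<open>T\<close>, not in \<open>D\<close>: a nabla derivative has domain \<open>kappa T\<close>, whose
  minimum may be left-scattered in \<open>T\<close>.\<close>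

definition ld_continuous_on :: "real set \<Rightarrow> real set \<Rightarrow> (real \<Rightarrow> real) \<Rightarrow> bool" where
  "ld_continuous_on T D f \<longleftrightarrow>
     (\<forall>t\<in>D. (ts_rho T t = t \<longrightarrow> continuous (at t within D) f) \<and>
            (ts_sigma T t = t \<longrightarrow> (\<exists>l. (f \<longlongrightarrow> l) (at t within D \<inter> {t<..}))))"

section \<open>The segment as a time scale\<close>

text \<open>Functions in \<open>C1_ld\<close> live on the segment \<open>[c,d]\<close> only, so the whole calculus is carried out
  in the time scale \<open>[c,d]\<close>. Its operators differ from those of \<open>T\<close> only in \<open>ts_rho c = c\<close> and
  \<open>ts_sigma d = d\<close>.\<close>

definition ts_Icc :: "real set \<Rightarrow> real \<Rightarrow> real \<Rightarrow> real set" where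
  "ts_Icc T c d = {t\<in>T. c \<le> t \<and> t \<le> d}"

definition ts_Icc_kappa :: "real set \<Rightarrow> real \<Rightarrow> real \<Rightarrow> real set" where
  "ts_Icc_kappa T c d = {t\<in>T. ts_sigma T c \<le> t \<and> t \<le> d}"

definition nabla_integral ::
    "real set \<Rightarrow> real \<Rightarrow> real \<Rightarrow> (real \<Rightarrow> real) \<Rightarrow> real" where
  "nabla_integral T c d f =
     (THE I. \<exists>F. (\<forall>t\<in>ts_Icc_kappa T c d. has_nabla_derivative (ts_Icc T c d) F (f t) t) \<and>
                 I = F d - F c)"

definition C1_ld :: "real set \<Rightarrow> real \<Rightarrow> real \<Rightarrow> (real \<Rightarrow> real) set" where
  "C1_ld T c d =
     {f. (\<forall>t\<in>ts_Icc_kappa T c d. \<exists>\<beta>. has_nabla_derivative (ts_Icc T c d) f \<beta> t) \<and>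
         ld_continuous_on (ts_Icc T c d) (ts_Icc_kappa T c d) (nabla_deriv (ts_Icc T c d) f)}"

text \<open>Suprema replace the maxima of the usual definition: an ld-continuous function on \<open>[c,d]\<close> is
  bounded, but need not attain its supremum at a right-dense, left-scattered point.\<close>

definition C1_ld_norm :: "real set \<Rightarrow> real \<Rightarrow> real \<Rightarrow> (real \<Rightarrow> real) \<Rightarrow> real" where
  "C1_ld_norm T c d f =
     (SUP t\<in>ts_Icc_kappa T c d. \<bar>f (ts_rho (ts_Icc T c d) t)\<bar>) +
     (SUP t\<in>ts_Icc_kappa T c d. \<bar>nabla_deriv (ts_Icc T c d) f t\<bar>)"

section \<open>Lagrangians\<close>

definition pd1 :: "(real \<Rightarrow> real \<Rightarrow> real) \<Rightarrow> real \<Rightarrow> real \<Rightarrow> real" where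
  "pd1 g x w = deriv (\<lambda>u. g u w) x"

definition pd2 :: "(real \<Rightarrow> real \<Rightarrow> real) \<Rightarrow> real \<Rightarrow> real \<Rightarrow> real" where
  "pd2 g x w = deriv (\<lambda>v. g x v) w"

definition C1_plane :: "(real \<Rightarrow> real \<Rightarrow> real) \<Rightarrow> bool" where
  "C1_plane g \<longleftrightarrow>
     (\<forall>x w. (\<lambda>u. g u w) differentiable (at x) \<and> (\<lambda>v. g x v) differentiable (at w)) \<and>
     continuous_on UNIV (\<lambda>(x, w). pd1 g x w) \<and> continuous_on UNIV (\<lambda>(x, w). pd2 g x w)"

definition C2_plane :: "(real \<Rightarrow> real \<Rightarrow> real) \<Rightarrow> bool" where
  "C2_plane g \<longleftrightarrow> C1_plane g \<and> C1_plane (pd1 g) \<and> C1_plane (pd2 g)"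

text \<open>Ld-continuity in the first of three variables, locally uniformly in the other two. This is
  what makes \<open>s \<mapsto> G s (u s) (v s)\<close> ld-continuous whenever \<open>u\<close> and \<open>v\<close> are; ld-continuity of
  each section \<open>s \<mapsto> G s x w\<close> separately would not suffice for that.\<close>

definition ld_continuous_param ::
    "real set \<Rightarrow> (real \<Rightarrow> real \<Rightarrow> real \<Rightarrow> real) \<Rightarrow> bool" where
  "ld_continuous_param T G \<longleftrightarrow>
     (\<forall>t\<in>T. \<forall>x w.
        (ts_rho T t = t \<longrightarrow>
           continuous (at (t, x, w) within T \<times> UNIV \<times> UNIV) (\<lambda>(s, x', w'). G s x' w')) \<and>
        (ts_sigma T t = t \<longrightarrow>
           (\<exists>l. ((\<lambda>(s, x', w'). G s x' w') \<longlongrightarrow> l)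
                  (at (t, x, w) within (T \<inter> {t<..}) \<times> UNIV \<times> UNIV))))"

text \<open>Regularity on the time scale \<open>T\<close> of a Lagrangian that is of class \<open>C2\<close> in \<open>(x, w)\<close> and
  ld-continuous in \<open>s\<close>. Ld-continuity of the first-order partial derivatives does not follow from
  the other two conditions; for instance with \<open>L s x w = w\<^sup>2 + s * \<phi> (x / s)\<close> for \<open>s > 0\<close>,
  \<open>L 0 x w = w\<^sup>2\<close> and a smooth bounded \<open>\<phi>\<close>, the map \<open>s \<mapsto> L_x s 0 w\<close> jumps at \<open>s = 0\<close> if
  the derivative of \<open>\<phi>\<close> at \<open>0\<close> is not zero.\<close>

definition regular_lagrangian ::
    "real set \<Rightarrow> (real \<Rightarrow> real \<Rightarrow> real \<Rightarrow> real) \<Rightarrow> bool" where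
  "regular_lagrangian T L \<longleftrightarrow>
     (\<forall>s\<in>T. C2_plane (L s)) \<and>
     (\<forall>x w. ld_continuous_on T T (\<lambda>s. L s x w)) \<and>
     ld_continuous_param T (\<lambda>s. pd1 (L s)) \<and>
     ld_continuous_param T (\<lambda>s. pd2 (L s))"

definition action ::
    "real set \<Rightarrow> real \<Rightarrow> real \<Rightarrow> (real \<Rightarrow> real \<Rightarrow> real \<Rightarrow> real) \<Rightarrow> (real \<Rightarrow> real) \<Rightarrow> real" where
  "action T c d L h =
     nabla_integral T c d
       (\<lambda>s. L s (h (ts_rho (ts_Icc T c d) s)) (nabla_deriv (ts_Icc T c d) h s))"

definition weak_local_min ::
    "real set \<Rightarrow> real \<Rightarrow> real \<Rightarrow> (real \<Rightarrow> real \<Rightarrow> real \<Rightarrow> real) \<Rightarrow> real \<Rightarrow> real \<Rightarrow>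
     (real \<Rightarrow> real) \<Rightarrow> bool" where
  "weak_local_min T c d L A B y0 \<longleftrightarrow>
     y0 \<in> C1_ld T c d \<and> y0 c = A \<and> y0 d = B \<and>
     (\<exists>\<delta>>0. \<forall>y\<in>C1_ld T c d.
        y c = A \<and> y d = B \<and> C1_ld_norm T c d (\<lambda>t. y t - y0 t) \<le> \<delta> \<longrightarrow>
        action T c d L y0 \<le> action T c d L y)"

section \<open>Consistency of the conventions\<close>

lemma kappa_ts_Icc:
  assumes "time_scale T" "c \<in> T" "d \<in> T" "c < d"
  shows "kappa (ts_Icc T c d) = ts_Icc_kappa T c d"
proof -
  let ?X = "ts_Icc T c d"
  have inf: "Inf ?X = c"
    using assms by (intro cInf_eq_minimum) (auto simp: ts_Icc_def)
  have bdd: "bdd_below ?X"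
    by (auto simp: ts_Icc_def intro!: bdd_belowI[of _ c])
  have A: "\<exists>s\<in>T. c < s" "\<exists>s\<in>?X. c < s"
    using assms by (auto simp: ts_Icc_def)
  have "Inf {s\<in>?X. c < s} = Inf {s\<in>T. c < s}"
  proof (rule antisym)
    have "Inf {s\<in>?X. c < s} \<le> s" if "s \<in> T" "c < s" for s
    proof (cases "s \<le> d")
      case True
      then show ?thesis
        using that by (intro cInf_lower bdd_belowI[of _ c]) (auto simp: ts_Icc_def)
    next
      case False
      have "Inf {s\<in>?X. c < s} \<le> d"
        using assms by (intro cInf_lower bdd_belowI[of _ c]) (auto simp: ts_Icc_def)
      then show ?thesis using False by simp
    qed
    then show "Inf {s\<in>?X. c < s} \<le> Inf {s\<in>T. c < s}"
      using A by (intro cInf_greatest) auto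
    show "Inf {s\<in>T. c < s} \<le> Inf {s\<in>?X. c < s}"
      using A by (intro cInf_superset_mono bdd_belowI[of _ c]) (auto simp: ts_Icc_def)
  qed
  then have sig: "ts_sigma ?X c = ts_sigma T c"
    using A by (simp add: ts_sigma_def)
  have "c \<le> ts_sigma T c"
    using A by (auto simp: ts_sigma_def intro!: cInf_greatest)
  then show ?thesis
    using bdd inf sig by (auto simp: kappa_def ts_Icc_def ts_Icc_kappa_def)
qed

text \<open>For \<open>s\<close> in \<open>[c,d]\<^sub>\<kappa>\<close> with \<open>ts_rho s\<close> in \<open>[c,d]\<^sub>\<kappa>\<close>, the nabla derivative at \<open>s\<close> of a function
  on \<open>[c,d]\<close> depends only on its values on \<open>[c,d]\<^sub>\<kappa>\<close>. The single other point is \<open>s = ts_sigma c\<close>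
  for right-scattered \<open>c\<close>, where \<open>ts_rho s = c\<close>. There \<open>y\<close> has no nabla derivative, so the
  function differentiated in the Euler--Lagrange equation has no prescribed value at \<open>c\<close>; the
  equation is stated for an extension of it from \<open>[c,d]\<^sub>\<kappa>\<close> to \<open>[c,d]\<close>.\<close>

lemma has_nabla_derivative_cong_kappa:
  assumes "time_scale T" "c \<in> T" "d \<in> T" "c < d"
    and p: "has_nabla_derivative (ts_Icc T c d) p \<beta> s"
    and eq: "\<And>r. r \<in> ts_Icc_kappa T c d \<Longrightarrow> p r = q r"
    and ts_rho_in: "ts_rho (ts_Icc T c d) s \<in> ts_Icc_kappa T c d"
  shows "has_nabla_derivative (ts_Icc T c d) q \<beta> s"
proof -
  let ?X = "ts_Icc T c d" and ?K = "ts_Icc_kappa T c d"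
  have sK: "s \<in> ?K"
    using p kappa_ts_Icc[OF assms(1-4)] by (simp add: has_nabla_derivative_def)
  have low: "ts_sigma T c \<le> r" if "r \<in> T" "c < r" for r
  proof -
    have "Inf {s\<in>T. c < s} \<le> r"
      using that by (intro cInf_lower bdd_belowI[of _ c]) auto
    then show ?thesis using that by (auto simp: ts_sigma_def)
  qed
  have "c \<le> ts_sigma T c"
    using assms by (auto simp: ts_sigma_def intro!: cInf_greatest)
  define V where "V = (if c \<in> ?K then UNIV else {c<..})"
  have "open V"
    by (simp add: V_def)
  have "s \<in> V"
  proof (cases "c \<in> ?K")
    case False
    then have "s \<noteq> c" using sK by metis
    then show ?thesis
      using sK \<open>c \<le> ts_sigma T c\<close> False by (simp add: V_def ts_Icc_kappa_def)
  qed (simp add: V_def)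
  note V = \<open>open V\<close> \<open>s \<in> V\<close>
  have VK: "r \<in> ?K" if r: "r \<in> V \<inter> ?X" for r
  proof (cases "c < r")
    case True
    then show ?thesis using r low[of r] by (simp add: ts_Icc_def ts_Icc_kappa_def)
  next
    case False
    then have "r = c" using r by (simp add: ts_Icc_def)
    moreover have "c \<in> ?K"
    proof (rule ccontr)
      assume "c \<notin> ?K"
      then have "V = {c<..}" by (simp add: V_def)
      then show False using r \<open>r = c\<close> by simp
    qed
    ultimately show ?thesis by simp
  qed
  have "\<exists>U. open U \<and> s \<in> U \<and>
      (\<forall>r\<in>U \<inter> ?X. \<bar>q (ts_rho ?X s) - q r - \<beta> * (ts_rho ?X s - r)\<bar> \<le> \<epsilon> * \<bar>ts_rho ?X s - r\<bar>)"
    if e: "\<epsilon> > 0" for \<epsilon>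
  proof -
    obtain U where U: "open U" "s \<in> U" and
      *: "\<forall>r\<in>U \<inter> ?X. \<bar>p (ts_rho ?X s) - p r - \<beta> * (ts_rho ?X s - r)\<bar> \<le> \<epsilon> * \<bar>ts_rho ?X s - r\<bar>"
      using p[unfolded has_nabla_derivative_def, THEN conjunct2, rule_format, OF e] by metis
    have "\<bar>q (ts_rho ?X s) - q r - \<beta> * (ts_rho ?X s - r)\<bar> \<le> \<epsilon> * \<bar>ts_rho ?X s - r\<bar>"
      if r: "r \<in> (U \<inter> V) \<inter> ?X" for r
    proof -
      have "p r = q r" "p (ts_rho ?X s) = q (ts_rho ?X s)"
        using eq[OF VK[of r]] eq[OF ts_rho_in] r by simp_all
      then show ?thesis using bspec[OF *, of r] r by simp
    qed
    moreover have "open (U \<inter> V)" "s \<in> U \<inter> V"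
      using U V by auto
    ultimately show ?thesis by (intro exI[of _ "U \<inter> V"] conjI ballI)
  qed
  moreover have "s \<in> kappa ?X"
    using p by (simp add: has_nabla_derivative_def)
  ultimately show ?thesis
    unfolding has_nabla_derivative_def by (intro conjI allI impI)
qed

end

theory Submission
  imports Defs
begin

text \<open>Let \<open>P\<close> be an antiderivative of \<open>L_x\<close> along \<open>y0\<close> and \<open>q = L_w - P\<close>, with mean value \<open>m\<close> over
  \<open>[c,d]\<close>. The variation \<open>\<eta>\<close> with \<open>\<eta> c = 0\<close> and nabla derivative \<open>m - q\<close> also vanishes at \<open>d\<close>, and by
  the product rule the first variation in its direction is the integral of \<open>- (q - m)\<^sup>2\<close>. Minimality
  makes it nonnegative, so the nondecreasing antiderivative of \<open>(q - m)\<^sup>2\<close> is constant, hence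
  \<open>q = m\<close> everywhere and \<open>L_w = P + m\<close>.\<close>

text \<open>Along \<open>y0\<close> the function \<open>L_w\<close> is only known to be
  ld-continuous, so it cannot be integrated by parts; \<open>L_x\<close> is integrated instead, as
  in du Bois-Reymond's argument. One well-chosen direction then replaces a family of bump functions:
  with \<open>P\<close> an antiderivative of \<open>L_x\<close>, the first variation in the
  direction \<eta> has integrand \<open>(P \<eta>)^nabla + m \<eta>^nabla - (q - m)^2\<close>, and
  the first two terms integrate to 0 because \<eta> vanishes at both ends. A constant antiderivative
  of \<open>(q - m)^2\<close> has nabla derivative 0 at every point of \<open>[c,d]_kappa\<close>,
  so the conclusion is pointwise and not merely almost everywhere. The obstacle is that
  ld-continuous functions may jump just to the right of a right-dense, left-scattered point. Uniform
  estimates therefore cannot come from continuity on a compact set. A covering argument supplies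
  them, using two-sided neighbourhoods at left-dense points and one-sided ones at right-dense
  points. The same points complicate monotonicity, since a nabla derivative there describes only the
  step from the left neighbour.\<close>

section \<open>Increments and limits in the plane\<close>

lemma differentiable_increment:
  fixes f :: "real \<Rightarrow> real"
  assumes "\<And>z. f differentiable (at z)"
  shows "\<exists>\<xi>. \<bar>\<xi> - x\<bar> \<le> \<bar>y - x\<bar> \<and> f y = f x + deriv f \<xi> * (y - x)"
proof -
  have D: "DERIV f z :> deriv f z" for z
    using assms by (simp add: DERIV_deriv_iff_real_differentiable)
  show ?thesis
  proof (cases x y rule: linorder_cases)
    case less
    then obtain z where "x < z" "z < y" "f y - f x = (y - x) * deriv f z"
      using MVT2[of x y f "deriv f"] D by blast
    then show ?thesis
      by (intro exI[of _ z]) (auto simp: algebra_simps)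
  next
    case greater
    then obtain z where "y < z" "z < x" "f x - f y = (x - y) * deriv f z"
      using MVT2[of y x f "deriv f"] D by blast
    then show ?thesis
      by (intro exI[of _ z]) (auto simp: algebra_simps)
  qed auto
qed

text \<open>The path from \<open>(x, w)\<close> to \<open>(x', w')\<close> is bent at
  \<open>(x, w')\<close>, so that each leg is a one-dimensional mean value theorem. This is why
  \<open>pd1\<close> is taken at height \<open>w'\<close> and \<open>pd2\<close> at abscissa
  \<open>x\<close>.\<close>

lemma C1_plane_increment:
  assumes "C1_plane g"
  shows "\<exists>\<xi> \<zeta>. \<bar>\<xi> - x\<bar> \<le> \<bar>x' - x\<bar> \<and> \<bar>\<zeta> - w\<bar> \<le> \<bar>w' - w\<bar> \<and>
    g x' w' = g x w + pd1 g \<xi> w' * (x' - x) + pd2 g x \<zeta> * (w' - w)"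
proof -
  obtain \<xi> where "\<bar>\<xi> - x\<bar> \<le> \<bar>x' - x\<bar>" "g x' w' = g x w' + pd1 g \<xi> w' * (x' - x)"
    using differentiable_increment[of "\<lambda>u. g u w'" x x'] assms by (auto simp: C1_plane_def pd1_def)
  moreover obtain \<zeta> where "\<bar>\<zeta> - w\<bar> \<le> \<bar>w' - w\<bar>" "g x w' = g x w + pd2 g x \<zeta> * (w' - w)"
    using differentiable_increment[of "\<lambda>v. g x v" w w'] assms by (auto simp: C1_plane_def pd2_def)
  ultimately show ?thesis
    by (intro exI[of _ \<xi>] exI[of _ \<zeta>]) simp
qed

text \<open>Meant for the intermediate points of the mean value theorem, about which nothing is
  known except their distance to the base point.\<close>

lemma tendsto_closer:
  fixes x \<xi> :: "'a \<Rightarrow> real"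
  assumes "(x \<longlongrightarrow> x0) F" "\<forall>\<^sub>F s in F. \<bar>\<xi> s - x0\<bar> \<le> \<bar>x s - x0\<bar>"
  shows "(\<xi> \<longlongrightarrow> x0) F"
proof (rule LIM_zero_cancel, rule Lim_null_comparison)
  show "\<forall>\<^sub>F s in F. norm (\<xi> s - x0) \<le> \<bar>x s - x0\<bar>" using assms(2) by simp
  show "((\<lambda>s. \<bar>x s - x0\<bar>) \<longlongrightarrow> 0) F"
    using assms(1) by (intro tendsto_rabs_zero LIM_zero)
qed

lemma eventually_withinI:
  "(\<And>s. s \<in> S \<Longrightarrow> s \<noteq> t \<Longrightarrow> P s) \<Longrightarrow> eventually P (at t within S)"
  by (simp add: eventually_at_filter)

text \<open>Passes from a limit of \<open>L s\<close> at the fixed point \<open>(x0, w0)\<close> to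
  a limit along a moving point. The partial derivatives at the intermediate points converge to some
  numbers, and their factors \<open>x s - x0\<close> and \<open>w s - w0\<close> tend to 0, so both
  correction terms vanish in the limit.\<close>

lemma C1_plane_family_tendsto:
  fixes L :: "real \<Rightarrow> real \<Rightarrow> real \<Rightarrow> real"
  assumes C1: "\<forall>\<^sub>F s in F. C1_plane (L s)"
    and x: "(x \<longlongrightarrow> x0) F" and w: "(w \<longlongrightarrow> w0) F"
    and l: "((\<lambda>s. L s x0 w0) \<longlongrightarrow> l) F"
    and p1: "\<And>\<xi> \<zeta>. (\<xi> \<longlongrightarrow> x0) F \<Longrightarrow> (\<zeta> \<longlongrightarrow> w0) F \<Longrightarrow>
      \<exists>k. ((\<lambda>s. pd1 (L s) (\<xi> s) (\<zeta> s)) \<longlongrightarrow> k) F"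
    and p2: "\<And>\<xi> \<zeta>. (\<xi> \<longlongrightarrow> x0) F \<Longrightarrow> (\<zeta> \<longlongrightarrow> w0) F \<Longrightarrow>
      \<exists>k. ((\<lambda>s. pd2 (L s) (\<xi> s) (\<zeta> s)) \<longlongrightarrow> k) F"
  shows "((\<lambda>s. L s (x s) (w s)) \<longlongrightarrow> l) F"
proof -
  let ?R = "\<lambda>s \<xi> \<zeta>. \<bar>\<xi> - x0\<bar> \<le> \<bar>x s - x0\<bar> \<and> \<bar>\<zeta> - w0\<bar> \<le> \<bar>w s - w0\<bar> \<and>
    L s (x s) (w s) = L s x0 w0 + pd1 (L s) \<xi> (w s) * (x s - x0) + pd2 (L s) x0 \<zeta> * (w s - w0)"
  \<comment> \<open>Both intermediate points are packed into one pair so that a single choice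
    function supplies them. The implication keeps the choice total where
    \<open>C1_plane (L s)\<close> fails.\<close>
  have "\<exists>q. C1_plane (L s) \<longrightarrow> ?R s (fst q) (snd q)" for s
    using C1_plane_increment[of "L s" x0 "x s" w0 "w s"] by (metis fst_conv snd_conv)
  then obtain q where q: "\<And>s. C1_plane (L s) \<Longrightarrow> ?R s (fst (q s)) (snd (q s))"
    by metis
  define \<xi> \<zeta> where "\<xi> = (\<lambda>s. fst (q s))" and "\<zeta> = (\<lambda>s. snd (q s))"
  have R: "\<forall>\<^sub>F s in F. ?R s (\<xi> s) (\<zeta> s)"
    using C1 by eventually_elim (use q in \<open>simp add: \<xi>_def \<zeta>_def\<close>)
  have "(\<xi> \<longlongrightarrow> x0) F" "(\<zeta> \<longlongrightarrow> w0) F"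
    by (rule tendsto_closer[OF x], use R in eventually_elim, simp)
      (rule tendsto_closer[OF w], use R in eventually_elim, simp)
  then obtain k1 k2 where k: "((\<lambda>s. pd1 (L s) (\<xi> s) (w s)) \<longlongrightarrow> k1) F"
      "((\<lambda>s. pd2 (L s) x0 (\<zeta> s)) \<longlongrightarrow> k2) F"
    using p1[OF _ w, of \<xi>] p2[OF tendsto_const, of \<zeta>] by blast
  have "((\<lambda>s. L s x0 w0 + pd1 (L s) (\<xi> s) (w s) * (x s - x0) + pd2 (L s) x0 (\<zeta> s) * (w s - w0))
      \<longlongrightarrow> l + k1 * (x0 - x0) + k2 * (w0 - w0)) F"
    by (intro tendsto_intros l k x w)
  moreover have "\<forall>\<^sub>F s in F. L s x0 w0 + pd1 (L s) (\<xi> s) (w s) * (x s - x0) +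
      pd2 (L s) x0 (\<zeta> s) * (w s - w0) = L s (x s) (w s)"
    using R by eventually_elim simp
  ultimately show ?thesis
    using Lim_transform_eventually by fastforce
qed

lemma dist_triple_le:
  fixes s t x y w z :: real
  shows "dist (s, x, w) (t, y, z) \<le> \<bar>s - t\<bar> + (\<bar>x - y\<bar> + \<bar>w - z\<bar>)"
proof -
  have "dist (x, w) (y, z) \<le> dist x y + dist w z"
    by (simp only: dist_Pair_Pair) (intro sqrt_sum_squares_le_sum zero_le_dist)
  moreover have "dist (s, x, w) (t, y, z) \<le> dist s t + dist (x, w) (y, z)"
    by (simp only: dist_Pair_Pair[of s _ t]) (intro sqrt_sum_squares_le_sum zero_le_dist)
  ultimately show ?thesis by (simp add: dist_real_def)
qed

text \<open>The filter leaves out the centre \<open>(t, x0, w0)\<close> only; points with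
  \<open>s = t\<close> and other \<open>x\<close>, \<open>w\<close> are covered by it. The premise
  on \<open>l\<close> fills in the centre when \<open>t\<close> lies in \<open>D\<close>, and is
  vacuous for a limit from the right.\<close>

lemma tendsto_triple_box:
  fixes G :: "real \<Rightarrow> real \<Rightarrow> real \<Rightarrow> real"
  assumes lim: "((\<lambda>(s, x, w). G s x w) \<longlongrightarrow> l) (at (t, x0, w0) within D \<times> UNIV \<times> UNIV)"
    and l: "t \<in> D \<Longrightarrow> l = G t x0 w0" and e: "e > 0"
  obtains \<eta> where "\<eta> > 0" "\<And>s x w. s \<in> D \<Longrightarrow> \<bar>s - t\<bar> < \<eta> \<Longrightarrow> \<bar>x - x0\<bar> < \<eta> \<Longrightarrow>
    \<bar>w - w0\<bar> < \<eta> \<Longrightarrow> \<bar>G s x w - l\<bar> < e"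
proof -
  obtain \<delta> where \<delta>: "\<delta> > 0"
    "\<And>q. q \<in> D \<times> UNIV \<times> UNIV \<Longrightarrow> q \<noteq> (t, x0, w0) \<Longrightarrow> dist q (t, x0, w0) < \<delta> \<Longrightarrow>
      dist (case q of (s, x, w) \<Rightarrow> G s x w) l < e"
    using tendstoD[OF lim e] unfolding eventually_at by metis
  show ?thesis
  proof (rule that[of "\<delta> / 3"])
    fix s x w assume s: "s \<in> D" and near: "\<bar>s - t\<bar> < \<delta> / 3" "\<bar>x - x0\<bar> < \<delta> / 3" "\<bar>w - w0\<bar> < \<delta> / 3"
    have "dist (s, x, w) (t, x0, w0) < \<delta>"
      using dist_triple_le[of s x w t x0 w0] near by linarith
    then show "\<bar>G s x w - l\<bar> < e"
      using \<delta>(2)[of "(s, x, w)"] s l e by (cases "(s, x, w) = (t, x0, w0)") (auto simp: dist_real_def)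
  qed (use \<delta> in simp)
qed

text \<open>Both values of \<open>G\<close> are compared with the common reference \<open>l\<close>,
  each at distance below \<open>e / 2\<close>. The radius \<eta> is split between the distance of
  \<open>(u s, v s)\<close> to \<open>(x0, w0)\<close> and that of \<open>(x, w)\<close> to
  \<open>(u s, v s)\<close>.\<close>

lemma uniform_box:
  fixes G :: "real \<Rightarrow> real \<Rightarrow> real \<Rightarrow> real"
  assumes "\<eta> > 0"
    and G: "\<And>s x w. s \<in> S \<Longrightarrow> \<bar>x - x0\<bar> < \<eta> \<Longrightarrow> \<bar>w - w0\<bar> < \<eta> \<Longrightarrow> \<bar>G s x w - l\<bar> < e / 2"
    and u: "\<And>s. s \<in> S \<Longrightarrow> \<bar>u s - x0\<bar> < \<eta> / 2" and v: "\<And>s. s \<in> S \<Longrightarrow> \<bar>v s - w0\<bar> < \<eta> / 2"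
  shows "\<exists>r>0. \<forall>s\<in>S. \<forall>x w. \<bar>x - u s\<bar> < r \<longrightarrow> \<bar>w - v s\<bar> < r \<longrightarrow> \<bar>G s x w - G s (u s) (v s)\<bar> \<le> e"
proof (intro exI[of _ "\<eta> / 2"] conjI ballI allI impI)
  fix s x w assume s: "s \<in> S" and near: "\<bar>x - u s\<bar> < \<eta> / 2" "\<bar>w - v s\<bar> < \<eta> / 2"
  have "\<bar>x - x0\<bar> < \<eta>" "\<bar>w - w0\<bar> < \<eta>" "\<bar>u s - x0\<bar> < \<eta>" "\<bar>v s - w0\<bar> < \<eta>"
    using near u[OF s] v[OF s] by linarith+
  then show "\<bar>G s x w - G s (u s) (v s)\<bar> \<le> e"
    using G[OF s, of x w] G[OF s, of "u s" "v s"] by linarith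
qed (use assms in simp)

section \<open>Nabla derivatives on a segment\<close>

locale ts_segment =
  fixes T :: "real set" and c d :: real
  assumes ts: "time_scale T" and cT: "c \<in> T" and dT: "d \<in> T" and cd: "c < d"
begin

abbreviation "X \<equiv> ts_Icc T c d"
abbreviation "K \<equiv> ts_Icc_kappa T c d"
abbreviation "\<rho> \<equiv> ts_rho X"
abbreviation "\<sigma> \<equiv> ts_sigma X"

section \<open>Jump operators of the segment\<close>

lemma cX [simp]: "c \<in> X" and dX [simp]: "d \<in> X"
  using cT dT cd by (auto simp: ts_Icc_def)

lemma X_bounds: "t \<in> X \<Longrightarrow> c \<le> t \<and> t \<le> d"
  by (simp add: ts_Icc_def)

lemma compact_X: "compact X"
proof -
  have "X = T \<inter> {c..d}"
    by (auto simp: ts_Icc_def)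
  then show ?thesis
    using ts by (simp add: time_scale_def closed_Int_compact)
qed

lemma Inf_X: "Inf X = c"
  using X_bounds by (intro cInf_eq_minimum) auto

lemma Sup_X: "Sup X = d"
  using X_bounds by (intro cSup_eq_maximum) auto

lemma Inf_above:
  assumes "S \<subseteq> X" "S \<noteq> {}"
  shows "Inf S \<in> X" and "\<And>s. s \<in> S \<Longrightarrow> Inf S \<le> s"
    and "\<And>e. e > 0 \<Longrightarrow> \<exists>s\<in>S. s < Inf S + e"
proof -
  have bdd: "bdd_below S"
    using assms X_bounds by (intro bdd_belowI[of _ c]) auto
  have "Inf S \<in> closure S"
    using assms bdd by (simp add: closure_contains_Inf)
  moreover have "closure S \<subseteq> X"
    using assms compact_X by (simp add: closure_minimal compact_imp_closed)
  ultimately show "Inf S \<in> X" by auto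
  show "\<And>s. s \<in> S \<Longrightarrow> Inf S \<le> s"
    using bdd by (simp add: cInf_lower)
  show "\<exists>s\<in>S. s < Inf S + e" if "e > 0" for e
    using cInf_lessD[OF assms(2), of "Inf S + e"] that by auto
qed

lemma Sup_below:
  assumes "S \<subseteq> X" "S \<noteq> {}"
  shows "Sup S \<in> X" and "\<And>s. s \<in> S \<Longrightarrow> s \<le> Sup S"
    and "\<And>e. e > 0 \<Longrightarrow> \<exists>s\<in>S. Sup S - e < s"
proof -
  have bdd: "bdd_above S"
    using assms X_bounds by (intro bdd_aboveI[of _ d]) auto
  have "Sup S \<in> closure S"
    using assms bdd by (simp add: closure_contains_Sup)
  moreover have "closure S \<subseteq> X"
    using assms compact_X by (simp add: closure_minimal compact_imp_closed)
  ultimately show "Sup S \<in> X" by auto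
  show "\<And>s. s \<in> S \<Longrightarrow> s \<le> Sup S"
    using bdd by (simp add: cSup_upper)
  show "\<exists>s\<in>S. Sup S - e < s" if "e > 0" for e
    using less_cSupD[OF assms(2), of "Sup S - e"] that by auto
qed

lemma rho_c [simp]: "\<rho> c = c"
proof -
  have "\<not> (\<exists>s\<in>X. s < c)"
    using X_bounds by force
  then show ?thesis
    using Inf_X by (simp add: ts_rho_def)
qed

lemma rho_eq: "\<lbrakk>t \<in> X; c < t\<rbrakk> \<Longrightarrow> \<rho> t = Sup {s\<in>X. s < t}"
  using cX unfolding ts_rho_def by auto

lemma rho_in: "t \<in> X \<Longrightarrow> \<rho> t \<in> X"
proof (cases "c < t")
  case True
  assume "t \<in> X"
  have "Sup {s\<in>X. s < t} \<in> X"
    using True cX by (intro Sup_below) blast+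
  then show ?thesis
    using rho_eq[OF \<open>t \<in> X\<close> True] by simp
next
  case False
  assume "t \<in> X"
  then have "t = c" using False X_bounds[of t] by simp
  then show ?thesis by simp
qed

lemma rho_ge: "\<lbrakk>t \<in> X; s \<in> X; s < t\<rbrakk> \<Longrightarrow> s \<le> \<rho> t"
  using Sup_below(2)[of "{s\<in>X. s < t}" s] rho_eq[of t] X_bounds[of s] by auto

lemma rho_le: "t \<in> X \<Longrightarrow> \<rho> t \<le> t"
proof (cases "c < t")
  case True
  assume "t \<in> X"
  have "Sup {s\<in>X. s < t} \<le> t"
    using True cX by (intro cSup_least) (blast, simp)
  then show ?thesis
    using rho_eq[OF \<open>t \<in> X\<close> True] by simp
next
  case False
  assume "t \<in> X"
  then have "t = c" using False X_bounds[of t] by simp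
  then show ?thesis by simp
qed

lemma left_dense_approx:
  assumes "t \<in> X" "c < t" "\<rho> t = t" "e > 0"
  obtains s where "s \<in> X" "t - e < s" "s < t"
proof -
  have "\<exists>s\<in>{s\<in>X. s < t}. Sup {s\<in>X. s < t} - e < s"
    using assms cX by (intro Sup_below) blast+
  then show ?thesis
    using that rho_eq[OF assms(1,2)] assms(3) by auto
qed

lemma sigma_eq: "t < d \<Longrightarrow> \<sigma> t = Inf {s\<in>X. t < s}"
  using dX unfolding ts_sigma_def by auto

lemma sigma_in: "t < d \<Longrightarrow> \<sigma> t \<in> X"
proof -
  assume t: "t < d"
  have "Inf {s\<in>X. t < s} \<in> X"
    using t dX by (intro Inf_above) blast+
  then show ?thesis
    using sigma_eq[OF t] by simp
qed

lemma sigma_le: "\<lbrakk>s \<in> X; t < s\<rbrakk> \<Longrightarrow> \<sigma> t \<le> s"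
  using Inf_above(2)[of "{s\<in>X. t < s}" s] sigma_eq[of t] X_bounds[of s] by auto

lemma sigma_ge: "t < d \<Longrightarrow> t \<le> \<sigma> t"
proof -
  assume t: "t < d"
  have "t \<le> Inf {s\<in>X. t < s}"
    using t dX by (intro cInf_greatest) (blast, simp)
  then show ?thesis
    using sigma_eq[OF t] by simp
qed

lemma right_dense_approx:
  assumes "t < d" "\<sigma> t = t" "e > 0"
  obtains s where "s \<in> X" "t < s" "s < t + e"
proof -
  have "\<exists>s\<in>{s\<in>X. t < s}. s < Inf {s\<in>X. t < s} + e"
    using assms dX by (intro Inf_above) blast+
  then show ?thesis
    using that sigma_eq[OF assms(1)] assms(2) by auto
qed

lemma rho_sigma:
  assumes "t \<in> X" "t < d" "t < \<sigma> t"
  shows "\<rho> (\<sigma> t) = t"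
proof -
  have s: "\<sigma> t \<in> X" "c < \<sigma> t"
    using assms sigma_in X_bounds[of t] by auto
  have "{s\<in>X. s < \<sigma> t} \<subseteq> {..t}"
  proof
    fix s assume "s \<in> {s\<in>X. s < \<sigma> t}"
    then show "s \<in> {..t}"
      using sigma_le[of s t] by (cases "t < s") auto
  qed
  then have "Sup {s\<in>X. s < \<sigma> t} = t"
    using assms by (intro cSup_eq_maximum) auto
  then show ?thesis
    using rho_eq[OF s] by simp
qed

lemma kappa_X: "kappa X = K"
  using kappa_ts_Icc ts cT dT cd .

text \<open>\<open>kappa\<close> removes the interval from \<open>c\<close> up to
  \<open>\<sigma> c\<close>, which contains at most the point \<open>c\<close> of
  \<open>X\<close>.\<close>

lemma K_iff: "t \<in> K \<longleftrightarrow> t \<in> X \<and> (c < t \<or> t = c \<and> \<sigma> c = c)"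
proof -
  have "bdd_below X"
    using X_bounds by (intro bdd_belowI[of _ c]) auto
  then have K: "K = X - {c..<\<sigma> c}"
    using kappa_X Inf_X by (simp add: kappa_def)
  show ?thesis
    using sigma_le[of t c] sigma_ge[OF cd] X_bounds[of t] unfolding K by auto
qed

lemma K_subset: "K \<subseteq> X"
  using K_iff by auto

lemma dK [simp]: "d \<in> K"
  using K_iff cd by simp

lemma right_dense_in_K: "\<lbrakk>t \<in> X; \<sigma> t = t\<rbrakk> \<Longrightarrow> t \<in> K"
  using K_iff X_bounds[of t] by (cases "t = c") auto

text \<open>To the right of \<open>t\<close>, \<open>\<rho> s\<close> lies between \<open>t\<close>
  and \<open>s\<close>. To the left, a point \<open>r\<close> of \<open>X\<close> close to
  \<open>t\<close> is a lower bound of \<open>\<rho> s\<close> as soon as \<open>s\<close> has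
  passed \<open>r\<close>.\<close>

lemma rho_tendsto_left_dense:
  assumes "t \<in> X" "\<rho> t = t"
  shows "(\<rho> \<longlongrightarrow> t) (at t within X)"
proof (rule tendstoI)
  fix e :: real assume e: "e > 0"
  obtain r where r: "r < t" "\<And>s. s \<in> X \<Longrightarrow> r < s \<Longrightarrow> s < t \<Longrightarrow> t - e < \<rho> s"
  proof (cases "c < t")
    case True
    obtain r where "r \<in> X" "t - e < r" "r < t"
      using left_dense_approx[OF assms(1) True assms(2) e] .
    then show ?thesis
      using that[of r] rho_ge by force
  next
    case False
    \<comment> \<open>Here \<open>t = c\<close>, and no point of \<open>X\<close> lies to the left,
      so any number below \<open>t\<close> serves as \<open>r\<close>.\<close>
    then show ?thesis
      using that[of "t - 1"] X_bounds[OF assms(1)] X_bounds by force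
  qed
  have "dist (\<rho> s) t < e" if s: "s \<in> X" "s \<noteq> t" "dist s t < min e (t - r)" for s
  proof (cases "s < t")
    case True
    have "t - e < \<rho> s"
      using r(2)[OF s(1) _ True] s(3) by (auto simp: dist_real_def abs_if split: if_splits)
    then show ?thesis
      using rho_le[OF s(1)] True by (simp add: dist_real_def)
  next
    case False
    then have "t \<le> \<rho> s"
      using rho_ge[OF s(1) assms(1)] s(2) by simp
    then show ?thesis
      using rho_le[OF s(1)] s(3) False by (simp add: dist_real_def)
  qed
  then show "\<forall>\<^sub>F s in at t within X. dist (\<rho> s) t < e"
    unfolding eventually_at using e r(1) by (intro exI[of _ "min e (t - r)"]) auto
qed

lemma rho_tendsto_right:
  assumes "t \<in> X"
  shows "(\<rho> \<longlongrightarrow> t) (at t within X \<inter> {t<..})"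
proof (rule tendsto_sandwich[where f="\<lambda>_. t" and h="\<lambda>s. s"])
  have ev: "\<forall>\<^sub>F s in at t within X \<inter> {t<..}. s \<in> X \<and> t < s"
    by (auto simp: eventually_at_filter)
  show "\<forall>\<^sub>F s in at t within X \<inter> {t<..}. t \<le> \<rho> s"
    using ev by eventually_elim (use rho_ge assms in blast)
  show "\<forall>\<^sub>F s in at t within X \<inter> {t<..}. \<rho> s \<le> s"
    using ev by eventually_elim (use rho_le in blast)
qed (rule tendsto_const tendsto_ident_at)+

section \<open>Nabla derivatives as ordinary derivatives or difference quotients, and their
  rules\<close>

lemma has_nabla_left_dense_iff:
  assumes "t \<in> K" "\<rho> t = t"
  shows "has_nabla_derivative X f \<beta> t \<longleftrightarrow> (f has_real_derivative \<beta>) (at t within X)"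
proof
  assume h: "has_nabla_derivative X f \<beta> t"
  have "\<exists>\<delta>>0. \<forall>s\<in>X. norm (s - t) < \<delta> \<longrightarrow> norm (f s - f t - \<beta> * (s - t)) \<le> e * norm (s - t)"
    if e: "e > 0" for e
  proof -
    obtain U where U: "open U" "t \<in> U"
      "\<And>s. s \<in> U \<inter> X \<Longrightarrow> \<bar>f t - f s - \<beta> * (t - s)\<bar> \<le> e * \<bar>t - s\<bar>"
      using h[unfolded has_nabla_derivative_def assms(2)] e by blast
    obtain \<delta> where \<delta>: "\<delta> > 0" "ball t \<delta> \<subseteq> U"
      using U openE by blast
    have "norm (f s - f t - \<beta> * (s - t)) \<le> e * norm (s - t)" if "s \<in> X" "norm (s - t) < \<delta>" for s
    proof -
      have "s \<in> U \<inter> X"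
        using \<delta> that by (auto simp: subset_iff dist_real_def abs_minus_commute)
      moreover have "f s - f t - \<beta> * (s - t) = - (f t - f s - \<beta> * (t - s))"
        by (simp add: algebra_simps)
      ultimately show ?thesis
        using U(3)[of s] by (simp only: real_norm_def abs_minus_cancel abs_minus_commute[of s t])
    qed
    then show ?thesis using \<delta> by blast
  qed
  then show "(f has_real_derivative \<beta>) (at t within X)"
    unfolding has_field_derivative_def has_derivative_within_alt
    by (auto simp: bounded_linear_mult_right)
next
  assume h: "(f has_real_derivative \<beta>) (at t within X)"
  have "\<exists>U. open U \<and> t \<in> U \<and> (\<forall>s\<in>U \<inter> X. \<bar>f t - f s - \<beta> * (t - s)\<bar> \<le> e * \<bar>t - s\<bar>)"
    if e: "e > 0" for e
  proof -
    obtain \<delta> where \<delta>: "\<delta> > 0"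
      "\<And>s. s \<in> X \<Longrightarrow> norm (s - t) < \<delta> \<Longrightarrow> norm (f s - f t - \<beta> * (s - t)) \<le> e * norm (s - t)"
      using h e unfolding has_field_derivative_def has_derivative_within_alt by blast
    have "\<bar>f t - f s - \<beta> * (t - s)\<bar> \<le> e * \<bar>t - s\<bar>" if "s \<in> ball t \<delta> \<inter> X" for s
    proof -
      have "f s - f t - \<beta> * (s - t) = - (f t - f s - \<beta> * (t - s))"
        by (simp add: algebra_simps)
      then show ?thesis
        using \<delta>(2)[of s] that
        by (simp only: real_norm_def abs_minus_cancel abs_minus_commute[of s t]) (auto simp: dist_real_def)
    qed
    then show ?thesis using \<delta> by (intro exI[of _ "ball t \<delta>"]) auto
  qed
  then show "has_nabla_derivative X f \<beta> t"
    using assms kappa_X by (auto simp: has_nabla_derivative_def)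
qed

text \<open>As \<open>s\<close> tends to \<open>t\<close>, the distance from \<open>s\<close> to
  \<open>\<rho> t\<close> stays near the positive number \<open>t - \<rho> t\<close>. The defining
  estimate thus says that the error \<open>?E s\<close> tends to 0 and vanishes at
  \<open>s = t\<close>: the first is continuity of \<open>f\<close>, the second fixes the difference
  quotient.\<close>

lemma has_nabla_left_scattered_iff:
  assumes "t \<in> K" "\<rho> t < t"
  shows "has_nabla_derivative X f \<beta> t \<longleftrightarrow>
    continuous (at t within X) f \<and> \<beta> * (t - \<rho> t) = f t - f (\<rho> t)"
proof
  have tX: "t \<in> X" using assms K_subset by auto
  let ?E = "\<lambda>s. f (\<rho> t) - f s - \<beta> * (\<rho> t - s)"
  assume h: "has_nabla_derivative X f \<beta> t"
  then have h': "\<exists>U. open U \<and> t \<in> U \<and> (\<forall>s\<in>U \<inter> X. \<bar>?E s\<bar> \<le> e * \<bar>\<rho> t - s\<bar>)" if "e > 0" for e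
    using that unfolding has_nabla_derivative_def by blast
  \<comment> \<open>The estimate at \<open>s = t\<close> itself, with the tolerance divided by
    \<open>t - \<rho> t\<close>.\<close>
  have "\<bar>?E t\<bar> \<le> 0 + e" if "e > 0" for e
  proof -
    have "e / (t - \<rho> t) > 0" using that assms by simp
    from h'[OF this] have "\<bar>?E t\<bar> \<le> e / (t - \<rho> t) * \<bar>\<rho> t - t\<bar>" using tX by blast
    then show ?thesis using assms by simp
  qed
  then have E0: "?E t = 0"
    by (meson field_le_epsilon abs_le_zero_iff)
  have E_lim: "(?E \<longlongrightarrow> 0) (at t within X)"
  proof (rule tendstoI)
    fix e :: real assume "e > 0"
    \<comment> \<open>For \<open>s\<close> within 1 of \<open>t\<close> the distance from
      \<open>\<rho> t\<close> to \<open>s\<close> is below \<open>t - \<rho> t + 1\<close>.\<close>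
    define e' where "e' = e / (t - \<rho> t + 1)"
    have e': "e' > 0" using \<open>e > 0\<close> assms by (simp add: e'_def)
    obtain U where U: "open U" "t \<in> U" "\<And>s. s \<in> U \<inter> X \<Longrightarrow> \<bar>?E s\<bar> \<le> e' * \<bar>\<rho> t - s\<bar>"
      using h'[OF e'] by blast
    obtain \<delta> where \<delta>: "\<delta> > 0" "ball t \<delta> \<subseteq> U"
      using U openE by blast
    have "dist (?E s) 0 < e" if s: "s \<in> X" "dist s t < min \<delta> 1" for s
    proof -
      have "\<bar>?E s\<bar> \<le> e' * \<bar>\<rho> t - s\<bar>"
        using U(3) \<delta> s by (auto simp: subset_iff dist_commute)
      also have "\<dots> < e' * (t - \<rho> t + 1)"
        using s e' assms by (intro mult_strict_left_mono) (auto simp: dist_real_def)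
      also have "\<dots> = e" using assms by (simp add: e'_def)
      finally show ?thesis by (simp add: dist_real_def)
    qed
    then show "\<forall>\<^sub>F s in at t within X. dist (?E s) 0 < e"
      unfolding eventually_at using \<delta> by (intro exI[of _ "min \<delta> 1"]) auto
  qed
  have "((\<lambda>s. f (\<rho> t) - \<beta> * (\<rho> t - s) - ?E s) \<longlongrightarrow> f (\<rho> t) - \<beta> * (\<rho> t - t) - 0) (at t within X)"
    by (intro tendsto_intros E_lim)
  moreover have "f (\<rho> t) - \<beta> * (\<rho> t - t) - 0 = f t" using E0 by simp
  moreover have "(\<lambda>s. f (\<rho> t) - \<beta> * (\<rho> t - s) - ?E s) = f" by auto
  ultimately have "(f \<longlongrightarrow> f t) (at t within X)" by simp
  then show "continuous (at t within X) f \<and> \<beta> * (t - \<rho> t) = f t - f (\<rho> t)"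
    using E0 by (auto simp: continuous_within algebra_simps)
next
  let ?E = "\<lambda>s. f (\<rho> t) - f s - \<beta> * (\<rho> t - s)"
  assume h: "continuous (at t within X) f \<and> \<beta> * (t - \<rho> t) = f t - f (\<rho> t)"
  then have E0: "?E t = 0" by (simp add: algebra_simps)
  have "continuous (at t within X) ?E"
    using h by (intro continuous_intros) auto
  then have lim: "(?E \<longlongrightarrow> 0) (at t within X)"
    unfolding continuous_within E0 .
  have "\<exists>U. open U \<and> t \<in> U \<and> (\<forall>s\<in>U \<inter> X. \<bar>?E s\<bar> \<le> e * \<bar>\<rho> t - s\<bar>)" if e: "e > 0" for e
  proof -
    \<comment> \<open>Within \<open>?\<nu> / 2\<close> of \<open>t\<close>, a point keeps distance
      at least \<open>?\<nu> / 2\<close> from \<open>\<rho> t\<close>, so a constant tolerance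
      \<open>e * (?\<nu> / 2)\<close> suffices.\<close>
    let ?\<nu> = "t - \<rho> t"
    have "e * (?\<nu> / 2) > 0" using e assms by simp
    from tendstoD[OF lim this] obtain \<delta> where \<delta>: "\<delta> > 0"
      "\<And>s. s \<in> X \<Longrightarrow> s \<noteq> t \<Longrightarrow> dist s t < \<delta> \<Longrightarrow> dist (?E s) 0 < e * (?\<nu> / 2)"
      unfolding eventually_at by blast
    have "\<bar>?E s\<bar> \<le> e * \<bar>\<rho> t - s\<bar>" if s: "s \<in> ball t (min \<delta> (?\<nu> / 2)) \<inter> X" for s
    proof (cases "s = t")
      case True
      then show ?thesis using E0 e by simp
    next
      case False
      have "\<bar>?E s\<bar> \<le> e * (?\<nu> / 2)"
        using \<delta>(2)[of s] False s by (simp add: dist_real_def abs_minus_commute)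
      also have "\<dots> \<le> e * \<bar>\<rho> t - s\<bar>"
        using s e by (intro mult_left_mono) (auto simp: dist_real_def abs_if split: if_splits)
      finally show ?thesis .
    qed
    then show ?thesis
      using \<delta> assms by (intro exI[of _ "ball t (min \<delta> (?\<nu> / 2))"]) auto
  qed
  then show "has_nabla_derivative X f \<beta> t"
    using assms kappa_X by (auto simp: has_nabla_derivative_def)
qed

lemma K_cases:
  assumes "t \<in> K"
  obtains "\<rho> t = t" | "\<rho> t < t"
  using assms rho_le[of t] K_subset by fastforce

lemma has_nabla_in_K: "has_nabla_derivative X f \<beta> t \<Longrightarrow> t \<in> K"
  by (simp add: has_nabla_derivative_def kappa_X)

lemmas has_nabla_iffs = has_nabla_left_dense_iff has_nabla_left_scattered_iff

lemma has_nabla_continuous: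
  assumes "has_nabla_derivative X f \<beta> t"
  shows "continuous (at t within X) f"
  using has_nabla_in_K[OF assms]
  by (rule K_cases) (use assms has_nabla_in_K[OF assms] in
      \<open>auto simp: has_nabla_iffs intro: DERIV_continuous\<close>)

lemma has_nabla_add:
  assumes "has_nabla_derivative X f a t" "has_nabla_derivative X g b t"
  shows "has_nabla_derivative X (\<lambda>s. f s + g s) (a + b) t"
  using has_nabla_in_K[OF assms(1)]
proof (rule K_cases)
  assume "\<rho> t = t"
  then show ?thesis
    using assms has_nabla_in_K[OF assms(1)] by (simp add: has_nabla_iffs DERIV_add)
next
  assume "\<rho> t < t"
  then show ?thesis
    using assms has_nabla_in_K[OF assms(1)]
    by (simp add: has_nabla_iffs continuous_add distrib_right)
qed

text \<open>In the scattered case the increment of the product is telescoped through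
  \<open>f t * g (\<rho> t)\<close>. Putting the shift on \<open>g\<close> matches the Lagrangian:
  for \<open>g = \<eta>\<close> the first term is \<open>a * \<eta> (\<rho> t)\<close>, the
  variation of the argument \<open>h (\<rho> t)\<close>.\<close>

lemma has_nabla_mult:
  assumes "has_nabla_derivative X f a t" "has_nabla_derivative X g b t"
  shows "has_nabla_derivative X (\<lambda>s. f s * g s) (a * g (\<rho> t) + f t * b) t"
  using has_nabla_in_K[OF assms(1)]
proof (rule K_cases)
  assume "\<rho> t = t"
  then show ?thesis
    using assms has_nabla_in_K[OF assms(1)] DERIV_mult[of f a t X g b]
    by (simp add: has_nabla_iffs mult.commute)
next
  assume *: "\<rho> t < t"
  have "(a * g (\<rho> t) + f t * b) * (t - \<rho> t) = (a * (t - \<rho> t)) * g (\<rho> t) + f t * (b * (t - \<rho> t))"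
    by (simp add: algebra_simps)
  with * show ?thesis
    using assms has_nabla_in_K[OF assms(1)]
    by (simp add: has_nabla_iffs continuous_mult) (simp add: algebra_simps)
qed

lemma has_nabla_const: "t \<in> K \<Longrightarrow> has_nabla_derivative X (\<lambda>_. k) 0 t"
  by (rule K_cases[of t]) (auto simp: has_nabla_iffs)

lemma has_nabla_ident: "t \<in> K \<Longrightarrow> has_nabla_derivative X (\<lambda>s. s) 1 t"
  by (rule K_cases[of t]) (auto simp: has_nabla_iffs)

lemma has_nabla_cmult:
  "has_nabla_derivative X f a t \<Longrightarrow> has_nabla_derivative X (\<lambda>s. k * f s) (k * a) t"
  using has_nabla_mult[OF has_nabla_const, of t f a k] has_nabla_in_K by simp

lemma has_nabla_diff:
  assumes "has_nabla_derivative X f a t" "has_nabla_derivative X g b t"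
  shows "has_nabla_derivative X (\<lambda>s. f s - g s) (a - b) t"
  using has_nabla_add[OF assms(1) has_nabla_cmult[OF assms(2), of "-1"]] by simp

text \<open>An antiderivative can be shown constant on \<open>X\<close> only, while
  \<open>has_nabla_const\<close> speaks of a globally constant function.\<close>

lemma has_nabla_const_on:
  assumes "t \<in> K" "\<And>s. s \<in> X \<Longrightarrow> f s = k"
  shows "has_nabla_derivative X f 0 t"
proof -
  have "f (\<rho> t) = k" using assms rho_in K_subset by auto
  then show ?thesis
    using assms kappa_X unfolding has_nabla_derivative_def by (auto intro!: exI[of _ UNIV])
qed

text \<open>Needed for uniqueness of the derivative. The delicate point is \<open>c\<close>, which
  is left-dense by convention; it belongs to \<open>K\<close> only if it is right-dense, and then it
  is approached from the right.\<close>

lemma left_dense_islimpt: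
  assumes "t \<in> K" "\<rho> t = t"
  shows "at t within X \<noteq> bot"
proof -
  have "t islimpt X"
    unfolding islimpt_approachable
  proof (intro allI impI)
    fix e :: real assume e: "e > 0"
    show "\<exists>s\<in>X. s \<noteq> t \<and> dist s t < e"
    proof (cases "c < t")
      case True
      then obtain s where "s \<in> X" "t - e < s" "s < t"
        using left_dense_approx[of t e] assms K_subset e by blast
      then show ?thesis
        by (intro bexI[of _ s]) (auto simp: dist_real_def)
    next
      case False
      then have "t = c" "\<sigma> c = c"
        using assms K_iff X_bounds by auto
      then obtain s where "s \<in> X" "t < s" "s < t + e"
        using right_dense_approx[of t e] cd e by auto
      then show ?thesis
        by (intro bexI[of _ s]) (auto simp: dist_real_def)
    qed
  qed
  then show ?thesis
    by (simp add: trivial_limit_within)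
qed

section \<open>Uniqueness of derivatives, monotonicity and the nabla integral\<close>

lemma has_nabla_unique:
  assumes "has_nabla_derivative X f a t" "has_nabla_derivative X f b t"
  shows "a = b"
  using has_nabla_in_K[OF assms(1)]
proof (rule K_cases)
  assume *: "\<rho> t = t"
  have t: "t \<in> K" using has_nabla_in_K[OF assms(1)] .
  show ?thesis
    by (rule tendsto_unique[OF left_dense_islimpt[OF t *]
          assms[unfolded has_nabla_left_dense_iff[OF t *] has_field_derivative_iff]])
next
  assume "\<rho> t < t"
  then have "a * (t - \<rho> t) = b * (t - \<rho> t)" "t - \<rho> t \<noteq> 0"
    using assms has_nabla_in_K[OF assms(1)] by (auto simp: has_nabla_iffs)
  then show ?thesis by simp
qed

lemma nabla_deriv_eq:
  "has_nabla_derivative X f a t \<Longrightarrow> nabla_deriv X f t = a"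
  unfolding nabla_deriv_def using has_nabla_unique by blast

text \<open>The gaps between \<open>\<rho> t\<close> and \<open>t\<close> are disjoint for different
  \<open>t\<close>, because \<open>t < u\<close> gives \<open>t \<le> \<rho> u\<close>. Each gap
  contains a rational.\<close>

lemma countable_left_scattered: "countable {t\<in>X. \<rho> t < t}"
proof -
  have "\<forall>t\<in>{t\<in>X. \<rho> t < t}. \<exists>q::rat. \<rho> t < of_rat q \<and> of_rat q < t"
    using of_rat_dense by blast
  then obtain q :: "real \<Rightarrow> rat"
    where q: "\<And>t. t \<in> X \<Longrightarrow> \<rho> t < t \<Longrightarrow> \<rho> t < of_rat (q t) \<and> of_rat (q t) < t"
    by (metis (mono_tags, lifting) mem_Collect_eq)
  have less: "q t < q u" if "t \<in> X" "\<rho> t < t" "u \<in> X" "\<rho> u < u" "t < u" for t u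
    using q[of t] q[of u] rho_ge[of u t] that of_rat_less[of "q t" "q u", where ?'a = real] by linarith
  have "inj_on q {t\<in>X. \<rho> t < t}"
  proof (rule inj_onI)
    fix t u assume "t \<in> {t\<in>X. \<rho> t < t}" "u \<in> {t\<in>X. \<rho> t < t}" "q t = q u"
    then show "t = u"
      using less[of t u] less[of u t] by (cases t u rule: linorder_cases) auto
  qed
  then show ?thesis
    by (rule countable_image_inj_on[rotated]) auto
qed

text \<open>The hypothesis says nothing at a right-scattered \<open>c\<close>, which lies outside
  \<open>K\<close>; there continuity is automatic because \<open>c\<close> is isolated in
  \<open>X\<close>.\<close>

lemma antiderivative_continuous_on:
  assumes "\<And>t. t \<in> K \<Longrightarrow> has_nabla_derivative X F (f t) t"
  shows "continuous_on X F"
  unfolding continuous_on_eq_continuous_within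
proof
  fix t assume t: "t \<in> X"
  show "continuous (at t within X) F"
  proof (cases "t \<in> K")
    case True
    then show ?thesis
      by (rule has_nabla_continuous[OF assms])
  next
    case False
    then have tc: "t = c" "c < \<sigma> c"
      using t K_iff[of t] X_bounds[OF t] sigma_ge[OF cd] by linarith+
    have "\<not> t islimpt X"
      unfolding islimpt_approachable
    proof
      assume "\<forall>e>0. \<exists>s\<in>X. s \<noteq> t \<and> dist s t < e"
      moreover have "\<sigma> c - c > 0" using tc by simp
      ultimately obtain s where "s \<in> X" "s \<noteq> t" "dist s t < \<sigma> c - c"
        by blast
      then show False
        using sigma_le[of s c] X_bounds[of s] tc by (auto simp: dist_real_def)
    qed
    then have "at t within X = bot"
      by (simp add: trivial_limit_within)
    then show ?thesis by simp
  qed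
qed

text \<open>A left-scattered right-dense point says nothing about the behaviour to its right. There are
  only countably many of them, so a level \<open>y\<close> that is not attained at any of them can be chosen.\<close>

lemma nabla_nonneg_imp_mono:
  assumes F: "\<And>t. t \<in> K \<Longrightarrow> has_nabla_derivative X F (f t) t"
    and nonneg: "\<And>t. t \<in> K \<Longrightarrow> 0 \<le> f t"
    and ab: "a \<in> X" "b \<in> X" "a \<le> b"
  shows "F a \<le> F b"
proof (rule ccontr)
  assume "\<not> F a \<le> F b"
  then have less: "F b < F a" by simp
  then have "a < b" using ab by (cases "a = b") auto
  \<comment> \<open>The tilt \<open>\<epsilon> * t\<close> uses up half of the drop from
    \<open>F a\<close> to \<open>F b\<close>: \<open>G\<close> still decreases from \<open>a\<close>
    to \<open>b\<close> although its nabla derivative is strictly positive.\<close>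
  define \<epsilon> where "\<epsilon> = (F a - F b) / (2 * (b - a))"
  have eps: "\<epsilon> > 0" using less \<open>a < b\<close> by (simp add: \<epsilon>_def)
  define G where "G = (\<lambda>t. F t + \<epsilon> * t)"
  have G: "has_nabla_derivative X G (f t + \<epsilon>) t" if "t \<in> K" for t
    using has_nabla_add[OF F[OF that] has_nabla_cmult[OF has_nabla_ident[OF that], of \<epsilon>]]
    by (simp add: G_def)
  have pos: "0 < f t + \<epsilon>" if "t \<in> K" for t
    using nonneg[OF that] eps by simp
  have contG: "continuous_on X G"
    using G by (rule antiderivative_continuous_on)
  have "\<epsilon> * (b - a) = (F a - F b) / 2"
    using \<open>a < b\<close> by (simp add: \<epsilon>_def field_simps)
  then have "G b < G a"
    using less by (simp add: G_def algebra_simps)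
  then have "uncountable {G b<..<G a}"
    by (simp add: uncountable_open_interval)
  moreover have "countable (G ` {t\<in>X. \<rho> t < t})"
    using countable_left_scattered by blast
  ultimately have "\<not> {G b<..<G a} \<subseteq> G ` {t\<in>X. \<rho> t < t}"
    using countable_subset by blast
  then obtain y where y: "G b < y" "y < G a" "y \<notin> G ` {t\<in>X. \<rho> t < t}"
    by (meson greaterThanLessThan_iff subsetI)
  define S where "S = (X \<inter> {a..b}) \<inter> G -` {y..}"
  have "closed S"
    unfolding S_def using compact_X contG
    by (intro continuous_closed_preimage)
      (auto intro: continuous_on_subset closed_Int compact_imp_closed)
  then have "compact (X \<inter> S)"
    using compact_X by (rule compact_Int_closed[rotated])
  moreover have "X \<inter> S = S" by (auto simp: S_def)
  ultimately have "compact S" by simp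
  moreover have "a \<in> S" using ab y by (simp add: S_def)
  \<comment> \<open>\<open>s\<close> is the last point of the segment from \<open>a\<close> to
    \<open>b\<close> at which \<open>G\<close> has not yet fallen below \<open>y\<close>. The
    contradiction comes from a later point where \<open>G\<close> still exceeds
    \<open>y\<close>.\<close>
  ultimately obtain s where s: "s \<in> S" and s_max: "\<And>t. t \<in> S \<Longrightarrow> t \<le> s"
    using compact_attains_sup[of S] by blast
  have sX: "s \<in> X" "a \<le> s" "s \<le> b" "y \<le> G s" using s by (auto simp: S_def)
  have "s < b" using sX y by (cases "s = b") auto
  then have "s < d" using X_bounds ab by force
  have above: "G t < y" if "t \<in> X" "s < t" "t \<le> b" for t
    using s_max[of t] that sX by (force simp: S_def)
  \<comment> \<open>If a gap followed \<open>s\<close>, the nabla derivative at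
    \<open>\<sigma> s\<close> would be the slope across that gap, and its positivity would keep
    \<open>\<sigma> s\<close> above the level \<open>y\<close>.\<close>
  have sig: "\<sigma> s = s"
  proof (rule ccontr)
    assume "\<sigma> s \<noteq> s"
    then have sc: "s < \<sigma> s" using sigma_ge[OF \<open>s < d\<close>] by simp
    have sg: "\<sigma> s \<in> X" "\<sigma> s \<le> b" "\<rho> (\<sigma> s) = s"
      using sigma_in sigma_le rho_sigma sX sc ab \<open>s < b\<close> \<open>s < d\<close> by auto
    have "\<sigma> s \<in> K"
      using sg sc sX X_bounds[of s] by (simp add: K_iff)
    with G[OF this] sg sc have "(f (\<sigma> s) + \<epsilon>) * (\<sigma> s - s) = G (\<sigma> s) - G s"
      using has_nabla_left_scattered_iff[of "\<sigma> s"] by simp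
    then have "G s < G (\<sigma> s)"
      using pos[OF \<open>\<sigma> s \<in> K\<close>] sc by (metis diff_gt_0_iff_gt mult_pos_pos)
    then show False
      using above[OF sg(1) sc sg(2)] sX by simp
  qed
  have "G s = y"
  proof (rule ccontr)
    assume "G s \<noteq> y"
    then have "y < G s" using sX by simp
    moreover have "(G \<longlongrightarrow> G s) (at s within X)"
      using contG sX by (simp add: continuous_on)
    ultimately have "\<forall>\<^sub>F t in at s within X. y < G t"
      by (simp add: order_tendstoD)
    then obtain \<delta> where \<delta>: "\<delta> > 0" "\<And>t. t \<in> X \<Longrightarrow> t \<noteq> s \<Longrightarrow> dist t s < \<delta> \<Longrightarrow> y < G t"
      unfolding eventually_at by blast
    have "min \<delta> (b - s) > 0" using \<delta> \<open>s < b\<close> by simp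
    then obtain t where t: "t \<in> X" "s < t" "t < s + min \<delta> (b - s)"
      using right_dense_approx[OF \<open>s < d\<close> sig] by metis
    then have "t < s + \<delta>" "t < b" by (auto simp: min_def split: if_splits)
    with t show False
      using above[of t] \<delta>(2)[of t] by (simp add: dist_real_def)
  qed
  \<comment> \<open>This is what the choice of \<open>y\<close> buys: the level is attained at
    \<open>s\<close>, so \<open>s\<close> is not left-scattered. Being left-dense, \<open>s\<close>
    has an ordinary derivative within \<open>X\<close>, which also controls \<open>G\<close> to the
    right.\<close>
  then have "\<rho> s = s"
    using y(3) sX(1) rho_le[OF sX(1)] by force
  moreover have sK: "s \<in> K"
    using right_dense_in_K sX sig by simp
  ultimately have "(G has_real_derivative (f s + \<epsilon>)) (at s within X)"
    using G[OF sK] has_nabla_left_dense_iff[OF sK] by simp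
  then obtain \<delta> where \<delta>: "\<delta> > 0" "\<And>h. h > 0 \<Longrightarrow> s + h \<in> X \<Longrightarrow> h < \<delta> \<Longrightarrow> G s < G (s + h)"
    using has_real_derivative_pos_inc_right[OF _ pos[OF sK]] by blast
  have "min \<delta> (b - s) > 0" using \<delta> \<open>s < b\<close> by simp
  then obtain t where t: "t \<in> X" "s < t" "t < s + min \<delta> (b - s)"
    using right_dense_approx[OF \<open>s < d\<close> sig] by metis
  then have "t < s + \<delta>" "t < b" by (auto simp: min_def split: if_splits)
  with t show False
    using above[of t] \<delta>(2)[of "t - s"] \<open>G s = y\<close> by simp
qed

lemma nabla_le_imp_increment_le:
  assumes "\<And>t. t \<in> K \<Longrightarrow> has_nabla_derivative X F (f t) t"
    and "\<And>t. t \<in> K \<Longrightarrow> has_nabla_derivative X G (g t) t"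
    and "\<And>t. t \<in> K \<Longrightarrow> f t \<le> g t"
  shows "F d - F c \<le> G d - G c"
proof -
  have "G c - F c \<le> G d - F d"
    using assms cd
    by (intro nabla_nonneg_imp_mono[where F = "\<lambda>t. G t - F t" and f = "\<lambda>t. g t - f t"])
      (auto intro: has_nabla_diff)
  then show ?thesis by simp
qed

text \<open>The description operator is well defined because two antiderivatives of \<open>f\<close>
  can be compared in both directions.\<close>

lemma nabla_integral_eq:
  assumes F: "\<And>t. t \<in> K \<Longrightarrow> has_nabla_derivative X F (f t) t"
  shows "nabla_integral T c d f = F d - F c"
  unfolding nabla_integral_def
proof (rule the_equality)
  show "\<exists>G. (\<forall>t\<in>K. has_nabla_derivative X G (f t) t) \<and> F d - F c = G d - G c"
    using F by blast
  show "I = F d - F c"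
    if "\<exists>G. (\<forall>t\<in>K. has_nabla_derivative X G (f t) t) \<and> I = G d - G c" for I
    using that nabla_le_imp_increment_le[of F f _ f] nabla_le_imp_increment_le[of _ f F f] F
    by (auto intro: antisym)
qed

section \<open>Ld-continuous functions\<close>

lemma sigma_d [simp]: "\<sigma> d = d"
proof -
  have "\<not> (\<exists>s\<in>X. d < s)"
    using X_bounds by force
  then show ?thesis
    using Sup_X by (simp add: ts_sigma_def)
qed

text \<open>A compactness principle for ld-continuity: a property stable under subsets and finite
  unions passes to all of \<open>K\<close> once it holds locally. The local hypotheses are shaped by
  what ld-continuity provides: a full neighbourhood at left-dense points, a right-hand one at
  right-dense points, and the bare point otherwise.\<close>

lemma local_to_global:
  assumes empty: "P {}"
    and mono: "\<And>S S'. P S \<Longrightarrow> S' \<subseteq> S \<Longrightarrow> P S'"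
    and union: "\<And>S S'. P S \<Longrightarrow> P S' \<Longrightarrow> P (S \<union> S')"
    and single: "\<And>t. t \<in> K \<Longrightarrow> P {t}"
    and left: "\<And>t. t \<in> K \<Longrightarrow> \<rho> t = t \<Longrightarrow> \<exists>U. open U \<and> t \<in> U \<and> P (U \<inter> K)"
    and right: "\<And>t. t \<in> K \<Longrightarrow> \<sigma> t = t \<Longrightarrow> \<exists>U. open U \<and> t \<in> U \<and> P (U \<inter> (K \<inter> {t<..}))"
  shows "P K"
proof -
  have "\<exists>U. open U \<and> t \<in> U \<and> P (U \<inter> K)" if t: "t \<in> X" for t
  proof (cases "t \<in> K \<and> \<rho> t \<noteq> t")
    case True
    then have sc: "\<rho> t < t" using rho_le[OF t] by simp
    have "\<exists>U. open U \<and> t \<in> U \<and> P (U \<inter> (K \<inter> {t<..}))"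
    proof (cases "\<sigma> t = t")
      case True
      then show ?thesis using right t \<open>t \<in> K \<and> \<rho> t \<noteq> t\<close> by blast
    next
      case False
      then have "t < d" using X_bounds[OF t] by (cases "t = d") auto
      then have "t < \<sigma> t" using sigma_ge[of t] False by simp
      moreover have "{..<\<sigma> t} \<inter> (K \<inter> {t<..}) = {}"
        using sigma_le K_subset by force
      ultimately show ?thesis using empty by (intro exI[of _ "{..<\<sigma> t}"]) simp
    qed
    then obtain U where U: "open U" "t \<in> U" "P (U \<inter> (K \<inter> {t<..}))" by blast
    have "P ({t} \<union> (U \<inter> (K \<inter> {t<..})))"
      using union single U True by blast
    \<comment> \<open>No point of \<open>X\<close> lies strictly between \<open>\<rho> t\<close> and
      \<open>t\<close>, so cutting at \<open>\<rho> t\<close> leaves \<open>t\<close> and points to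
      its right.\<close>
    moreover have "(U \<inter> {\<rho> t<..}) \<inter> K \<subseteq> {t} \<union> (U \<inter> (K \<inter> {t<..}))"
      using rho_ge[OF t] K_subset by force
    ultimately have "P ((U \<inter> {\<rho> t<..}) \<inter> K)"
      using mono by blast
    then show ?thesis
      using U sc by (intro exI[of _ "U \<inter> {\<rho> t<..}"]) auto
  next
    case False
    show ?thesis
    proof (cases "t \<in> K")
      case True
      then show ?thesis using False left by blast
    next
      case F: False
      \<comment> \<open>The cover has to reach all of the compact set \<open>X\<close>, including a
        right-scattered \<open>c\<close> outside \<open>K\<close>; the gap after \<open>c\<close>
        gives a neighbourhood that misses \<open>K\<close>.\<close>
      then have tc: "t = c" "\<sigma> c \<noteq> c"
        using t K_iff[of t] X_bounds[OF t] by auto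
      then have "c < \<sigma> c" using sigma_ge[OF cd] by simp
      moreover have "{..<\<sigma> c} \<inter> K = {}"
        using sigma_le K_iff tc by force
      ultimately show ?thesis using empty tc by (intro exI[of _ "{..<\<sigma> c}"]) simp
    qed
  qed
  then obtain U where U: "\<And>t. t \<in> X \<Longrightarrow> open (U t) \<and> t \<in> U t \<and> P (U t \<inter> K)"
    by metis
  obtain D where D: "D \<subseteq> X" "finite D" "X \<subseteq> (\<Union>t\<in>D. U t)"
    by (rule compactE_image[OF compact_X, of X U]) (use U in auto)
  have "P (\<Union>t\<in>D. U t \<inter> K)"
    using D(2,1) by (induction D) (use empty union U in auto)
  moreover have "K \<subseteq> (\<Union>t\<in>D. U t \<inter> K)"
    using D K_subset by auto
  ultimately show "P K" using mono by blast
qed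

abbreviation ld :: "(real \<Rightarrow> real) \<Rightarrow> bool" where
  "ld \<equiv> ld_continuous_on X K"

lemma ld_left: "\<lbrakk>ld f; t \<in> K; \<rho> t = t\<rbrakk> \<Longrightarrow> (f \<longlongrightarrow> f t) (at t within K)"
  by (simp add: ld_continuous_on_def continuous_within)

lemma ld_right:
  assumes "ld f" "t \<in> K" "\<sigma> t = t"
  obtains l where "(f \<longlongrightarrow> l) (at t within K \<inter> {t<..})"
  using assms by (auto simp: ld_continuous_on_def)

lemma ldI:
  assumes "\<And>t. t \<in> K \<Longrightarrow> \<rho> t = t \<Longrightarrow> (f \<longlongrightarrow> f t) (at t within K)"
    and "\<And>t. t \<in> K \<Longrightarrow> \<sigma> t = t \<Longrightarrow> \<exists>l. (f \<longlongrightarrow> l) (at t within K \<inter> {t<..})"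
  shows "ld f"
  using assms by (simp add: ld_continuous_on_def continuous_within)

lemma ld_locally_left:
  assumes "ld f" "t \<in> K" "\<rho> t = t" "e > 0"
  shows "\<exists>U. open U \<and> t \<in> U \<and> (\<forall>s\<in>U \<inter> K. \<bar>f s - f t\<bar> < e)"
proof -
  obtain U where U: "open U" "t \<in> U"
    "\<And>s. s \<in> U \<Longrightarrow> s \<noteq> t \<Longrightarrow> s \<in> K \<Longrightarrow> dist (f s) (f t) < e"
    using tendstoD[OF ld_left[OF assms(1-3)] assms(4)] unfolding eventually_at_topological by blast
  have "\<bar>f s - f t\<bar> < e" if "s \<in> U \<inter> K" for s
    using U(3)[of s] that assms(4) by (cases "s = t") (auto simp: dist_real_def)
  with U show ?thesis by blast
qed

lemma ld_locally_right:
  assumes "ld f" "t \<in> K" "\<sigma> t = t"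
  shows "\<exists>l. \<forall>e>0. \<exists>U. open U \<and> t \<in> U \<and> (\<forall>s\<in>U \<inter> (K \<inter> {t<..}). \<bar>f s - l\<bar> < e)"
proof -
  obtain l where l: "(f \<longlongrightarrow> l) (at t within K \<inter> {t<..})"
    using ld_right[OF assms] by metis
  have "\<exists>U. open U \<and> t \<in> U \<and> (\<forall>s\<in>U \<inter> (K \<inter> {t<..}). \<bar>f s - l\<bar> < e)" if e: "e > 0" for e
  proof -
    obtain U where U: "open U" "t \<in> U"
      "\<And>s. s \<in> U \<Longrightarrow> s \<noteq> t \<Longrightarrow> s \<in> K \<inter> {t<..} \<Longrightarrow> dist (f s) l < e"
      using tendstoD[OF l e] unfolding eventually_at_topological by metis
    have "\<bar>f s - l\<bar> < e" if "s \<in> U \<inter> (K \<inter> {t<..})" for s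
      using U(3)[of s] that by (auto simp: dist_real_def)
    with U show ?thesis by metis
  qed
  then show ?thesis by metis
qed

lemma ld_bounded:
  assumes "ld f"
  obtains M where "M > 0" "\<And>s. s \<in> K \<Longrightarrow> \<bar>f s\<bar> \<le> M"
proof -
  have "\<exists>M. \<forall>s\<in>K. \<bar>f s\<bar> \<le> M"
  proof (rule local_to_global[where P = "\<lambda>S. \<exists>M. \<forall>s\<in>S. \<bar>f s\<bar> \<le> M"])
    fix S S' assume "\<exists>M. \<forall>s\<in>S. \<bar>f s\<bar> \<le> M" "\<exists>M. \<forall>s\<in>S'. \<bar>f s\<bar> \<le> M"
    then obtain M M' where "\<And>s. s \<in> S \<Longrightarrow> \<bar>f s\<bar> \<le> M" "\<And>s. s \<in> S' \<Longrightarrow> \<bar>f s\<bar> \<le> M'" by blast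
    then show "\<exists>M. \<forall>s\<in>S \<union> S'. \<bar>f s\<bar> \<le> M"
      by (intro exI[of _ "max M M'"]) force
  next
    fix t assume t: "t \<in> K" "\<rho> t = t"
    show "\<exists>U. open U \<and> t \<in> U \<and> (\<exists>M. \<forall>s\<in>U \<inter> K. \<bar>f s\<bar> \<le> M)"
      using ld_locally_left[OF assms t zero_less_one] by (force intro: exI[of _ "\<bar>f t\<bar> + 1"])
  next
    fix t assume t: "t \<in> K" "\<sigma> t = t"
    then obtain l where l: "\<And>e. e > 0 \<Longrightarrow>
        \<exists>U. open U \<and> t \<in> U \<and> (\<forall>s\<in>U \<inter> (K \<inter> {t<..}). \<bar>f s - l\<bar> < e)"
      using ld_locally_right[OF assms] by blast
    show "\<exists>U. open U \<and> t \<in> U \<and> (\<exists>M. \<forall>s\<in>U \<inter> (K \<inter> {t<..}). \<bar>f s\<bar> \<le> M)"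
      using l[OF zero_less_one] by (force intro: exI[of _ "\<bar>l\<bar> + 1"])
  qed auto
  then obtain M where "\<And>s. s \<in> K \<Longrightarrow> \<bar>f s\<bar> \<le> M" by blast
  then show ?thesis
    using that[of "max M 1"] by force
qed

section \<open>Existence of antiderivatives\<close>

lemma closed_K: "closed K"
proof -
  have "K = T \<inter> {ts_sigma T c..d}"
    by (auto simp: ts_Icc_kappa_def)
  then show ?thesis
    using ts by (simp add: time_scale_def closed_Int)
qed

text \<open>Locally \<open>f\<close> is within \<open>e\<close> of a constant, namely its value or
  its right-hand limit. Gluing finitely many constants gives Borel functions that approximate
  \<open>f\<close> uniformly on \<open>K\<close>.\<close>

lemma ld_borel_measurable:
  assumes "ld f"
  shows "(\<lambda>s. indicator K s * f s) \<in> borel_measurable borel"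
proof -
  \<comment> \<open>\<open>local_to_global\<close> asks for stability under arbitrary subsets, which
    may fail to be Borel; hence the Borel superset \<open>S'\<close> on which the approximation
    holds and along which functions are glued.\<close>
  define P where "P = (\<lambda>e S. \<exists>\<phi>\<in>borel_measurable borel. \<exists>S'\<in>sets borel.
    S \<subseteq> S' \<and> (\<forall>s\<in>S' \<inter> K. \<bar>f s - \<phi> s\<bar> < (e::real)))"
  have "P e K" if e: "e > 0" for e
  proof (rule local_to_global[where P = "P e"])
    show "P e {}"
      unfolding P_def by (intro bexI[of _ "\<lambda>_. 0"] bexI[of _ "{}"]) auto
    show "P e S'" if "P e S" "S' \<subseteq> S" for S S'
      using that unfolding P_def by blast
    show "P e {t}" for t
      unfolding P_def using e by (intro bexI[of _ "\<lambda>_. f t"] bexI[of _ "{t}"]) auto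
    show "P e (S1 \<union> S2)" if P12: "P e S1" "P e S2" for S1 S2
    proof -
      obtain \<phi>1 S1' where 1: "\<phi>1 \<in> borel_measurable borel" "S1' \<in> sets borel" "S1 \<subseteq> S1'"
        "\<And>s. s \<in> S1' \<inter> K \<Longrightarrow> \<bar>f s - \<phi>1 s\<bar> < e"
        using P12(1) unfolding P_def by blast
      obtain \<phi>2 S2' where 2: "\<phi>2 \<in> borel_measurable borel" "S2' \<in> sets borel" "S2 \<subseteq> S2'"
        "\<And>s. s \<in> S2' \<inter> K \<Longrightarrow> \<bar>f s - \<phi>2 s\<bar> < e"
        using P12(2) unfolding P_def by blast
      have "(\<lambda>s. if s \<in> S1' then \<phi>1 s else \<phi>2 s) \<in> borel_measurable borel"
        using 1 2 by (intro measurable_If_set) auto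
      then show ?thesis
        unfolding P_def using 1 2
        by (intro bexI[of _ "\<lambda>s. if s \<in> S1' then \<phi>1 s else \<phi>2 s"] bexI[of _ "S1' \<union> S2'"]) auto
    qed
    show "\<exists>U. open U \<and> t \<in> U \<and> P e (U \<inter> K)" if t: "t \<in> K" "\<rho> t = t" for t
    proof -
      obtain U where U: "open U" "t \<in> U" "\<And>s. s \<in> U \<inter> K \<Longrightarrow> \<bar>f s - f t\<bar> < e"
        using ld_locally_left[OF assms t e] by blast
      then have "P e (U \<inter> K)"
        unfolding P_def by (intro bexI[of _ "\<lambda>_. f t"] bexI[of _ U]) auto
      with U show ?thesis by blast
    qed
    show "\<exists>U. open U \<and> t \<in> U \<and> P e (U \<inter> (K \<inter> {t<..}))" if t: "t \<in> K" "\<sigma> t = t" for t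
    proof -
      obtain l U where U: "open U" "t \<in> U" "\<And>s. s \<in> U \<inter> (K \<inter> {t<..}) \<Longrightarrow> \<bar>f s - l\<bar> < e"
        using ld_locally_right[OF assms t] e by blast
      then have "P e (U \<inter> (K \<inter> {t<..}))"
        unfolding P_def by (intro bexI[of _ "\<lambda>_. l"] bexI[of _ "U \<inter> {t<..}"]) auto
      with U show ?thesis by blast
    qed
  qed
  then have "P (inverse (real (Suc n))) K" for n
    by simp
  then have "\<exists>\<phi>. \<phi> \<in> borel_measurable borel \<and>
      (\<forall>s\<in>K. \<bar>f s - \<phi> s\<bar> < inverse (real (Suc n)))" for n
    unfolding P_def by blast
  then obtain \<phi> where \<phi>: "\<And>n. \<phi> n \<in> borel_measurable borel"
      "\<And>n s. s \<in> K \<Longrightarrow> \<bar>f s - \<phi> n s\<bar> < inverse (real (Suc n))"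
    by metis
  show ?thesis
  proof (rule borel_measurable_LIMSEQ_real)
    show "(\<lambda>s. indicator K s * \<phi> n s) \<in> borel_measurable borel" for n
      using \<phi>(1) closed_K by (intro borel_measurable_times borel_measurable_indicator) auto
    show "(\<lambda>n. indicator K s * \<phi> n s) \<longlonglongrightarrow> indicator K s * f s" for s
    proof (cases "s \<in> K")
      case True
      have "(\<lambda>n. \<phi> n s) \<longlonglongrightarrow> f s"
        by (rule LIM_zero_cancel, rule tendsto_rabs_zero_cancel,
            rule tendsto_sandwich[OF _ _ tendsto_const LIMSEQ_inverse_real_of_nat])
          (use \<phi>(2)[OF True] in \<open>auto simp: abs_minus_commute less_imp_le\<close>)
      then show ?thesis using True by simp
    qed simp
  qed
qed

text \<open>The nabla integral of \<open>f\<close> is the Lebesgue integral of \<open>f\<close> composed with the map sending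
  \<open>\<tau>\<close> to the next point of the time scale.\<close>

lemma ld_antiderivative:
  assumes f: "ld f"
  obtains F where "\<And>t. t \<in> K \<Longrightarrow> has_nabla_derivative X F (f t) t"
proof -
  \<comment> \<open>Capping at \<open>d\<close> keeps the set nonempty, so \<open>nxt\<close> is
    monotone on the whole line and therefore Borel.\<close>
  define nxt where "nxt = (\<lambda>\<tau>. Inf {s\<in>X. min \<tau> d \<le> s})"
  have nxt: "nxt \<tau> \<in> {s\<in>X. min \<tau> d \<le> s}" for \<tau>
  proof -
    have "d \<in> {s\<in>X. min \<tau> d \<le> s}" by simp
    then have ne: "{s\<in>X. min \<tau> d \<le> s} \<noteq> {}" by blast
    have "nxt \<tau> \<in> X"
      unfolding nxt_def by (rule Inf_above(1)[OF _ ne]) blast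
    moreover have "min \<tau> d \<le> nxt \<tau>"
      unfolding nxt_def by (rule cInf_greatest[OF ne]) blast
    ultimately show ?thesis by simp
  qed
  have nxt_le: "nxt \<tau> \<le> s" if "s \<in> X" "min \<tau> d \<le> s" for \<tau> s
    unfolding nxt_def using that by (intro Inf_above(2)) auto
  have "mono nxt"
    by (rule monoI, rule nxt_le) (use nxt in \<open>auto intro: order_trans[OF min.mono]\<close>)
  then have nxt_borel: "nxt \<in> borel_measurable borel"
    by (rule borel_measurable_mono)
  \<comment> \<open>For \<tau> up to \<open>c\<close> the next point is \<open>c\<close>, which is
    outside \<open>K\<close> if \<open>c\<close> is right-scattered; \<open>f\<close> is controlled
    on \<open>K\<close> only, and the indicator puts 0 there.\<close>
  define g where "g = (\<lambda>\<tau>. indicator K (nxt \<tau>) * f (nxt \<tau>))"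
  have g_borel: "g \<in> borel_measurable borel"
    unfolding g_def using measurable_compose[OF nxt_borel ld_borel_measurable[OF f]] .
  obtain M where M: "M > 0" "\<And>s. s \<in> K \<Longrightarrow> \<bar>f s\<bar> \<le> M"
    using ld_bounded[OF f] by metis
  have g_bound: "norm (g \<tau>) \<le> M" for \<tau>
    using M by (simp add: g_def indicator_def)
  have g_int: "g integrable_on {a..b}" for a b
  proof (rule measurable_bounded_by_integrable_imp_integrable)
    show "g \<in> borel_measurable (lebesgue_on {a..b})"
      using g_borel by (intro measurable_restrict_space1 measurable_completion) simp
    show "(\<lambda>_. M) integrable_on {a..b}" by (rule integrable_const_ivl)
  qed (use g_bound in auto)
  define F where "F = (\<lambda>t. integral {c..t} g)"
  \<comment> \<open>For \<tau> in the half-open interval from \<open>s\<close> (excluded) to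
    \<open>t\<close>, \<open>nxt \<tau>\<close> stays in that interval, so a bound for
    \<open>f - k\<close> there bounds the integral. The cases used are \<open>k = 0\<close> with
    \<open>e = M\<close> (Lipschitz bound), and \<open>k = f t\<close> with \<open>e = 0\<close>
    (scattered) or \<open>e > 0\<close> (dense).\<close>
  have key: "\<bar>F t - F s - k * (t - s)\<bar> \<le> e * (t - s)"
    if st: "s \<in> X" "t \<in> X" "s < t" and e: "0 \<le> e"
      and near: "\<And>r. r \<in> K \<Longrightarrow> s < r \<Longrightarrow> r \<le> t \<Longrightarrow> \<bar>f r - k\<bar> \<le> e" for s t k e
  proof -
    have "integral {c..s} g + integral {s..t} g = integral {c..t} g"
      using st X_bounds g_int by (intro Henstock_Kurzweil_Integration.integral_combine) auto
    then have "integral {s..t} g = F t - F s"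
      by (simp add: F_def)
    then have g_st: "(g has_integral F t - F s) {s..t}"
      using integrable_integral[OF g_int[of s t]] by simp
    have k_st: "((\<lambda>_. k) has_integral k * (t - s)) {s..t}"
      using has_integral_const_real[of k s t] st by (simp add: mult.commute)
    have hi: "((\<lambda>\<tau>. g \<tau> - k) has_integral F t - F s - k * (t - s)) (cbox s t)"
      using has_integral_diff[OF g_st k_st] by simp
    \<comment> \<open>The left endpoint is discarded: \<open>nxt s = s\<close>, a point about which
      \<open>near\<close> says nothing.\<close>
    have "norm (F t - F s - k * (t - s)) \<le> e * measure lborel (cbox s t)"
    proof (rule has_integral_bound_spike_finite[OF e _ hi, of "{s}"])
      fix \<tau> assume "\<tau> \<in> cbox s t - {s}"
      then have \<tau>: "s < \<tau>" "\<tau> \<le> t" by auto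
      then have "nxt \<tau> \<in> X" "\<tau> \<le> nxt \<tau>" "nxt \<tau> \<le> t"
        using nxt[of \<tau>] nxt_le[of t \<tau>] st X_bounds[of t] by auto
      moreover from this \<tau> have "nxt \<tau> \<in> K"
        using X_bounds[OF st(1)] by (simp add: K_iff)
      ultimately show "norm (g \<tau> - k) \<le> e"
        using near[of "nxt \<tau>"] \<tau> by (simp add: g_def)
    qed simp
    then show ?thesis using st by simp
  qed
  have lip: "\<bar>F t - F s\<bar> \<le> M * \<bar>t - s\<bar>" if "s \<in> X" "t \<in> X" for s t
    using key[of s t M 0] key[of t s M 0] that M by (cases s t rule: linorder_cases) auto
  have "has_nabla_derivative X F (f t) t" if t: "t \<in> K" for t
    using t
  proof (rule K_cases)
    have tX: "t \<in> X" using t K_subset by auto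
    assume sc: "\<rho> t < t"
    \<comment> \<open>The error is exactly 0, as \<open>t\<close> is the only point of
      \<open>K\<close> after \<open>\<rho> t\<close> and up to \<open>t\<close>.\<close>
    have "\<bar>F t - F (\<rho> t) - f t * (t - \<rho> t)\<bar> \<le> 0 * (t - \<rho> t)"
    proof (rule key[OF rho_in[OF tX] tX sc])
      fix r assume "r \<in> K" "\<rho> t < r" "r \<le> t"
      then have "r = t" using rho_ge[OF tX, of r] K_subset by force
      then show "\<bar>f r - f t\<bar> \<le> 0" by simp
    qed simp
    moreover have "continuous (at t within X) F"
      unfolding continuous_within
    proof (rule LIM_zero_cancel, rule Lim_null_comparison)
      show "\<forall>\<^sub>F s in at t within X. norm (F s - F t) \<le> M * \<bar>s - t\<bar>"
        using lip tX by (intro eventually_withinI) simp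
      have "((\<lambda>s. M * \<bar>s - t\<bar>) \<longlongrightarrow> M * \<bar>t - t\<bar>) (at t within X)"
        by (intro tendsto_intros)
      then show "((\<lambda>s. M * \<bar>s - t\<bar>) \<longlongrightarrow> 0) (at t within X)" by simp
    qed
    ultimately show ?thesis
      using has_nabla_left_scattered_iff[OF t sc] by simp
  next
    have tX: "t \<in> X" using t K_subset by auto
    assume de: "\<rho> t = t"
    have "\<exists>\<delta>>0. \<forall>s\<in>X. norm (s - t) < \<delta> \<longrightarrow> norm (F s - F t - f t * (s - t)) \<le> e * norm (s - t)"
      if e: "e > 0" for e
    proof -
      obtain U where U: "open U" "t \<in> U" "\<And>s. s \<in> U \<inter> K \<Longrightarrow> \<bar>f s - f t\<bar> < e"
        using ld_locally_left[OF f t de e] by metis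
      then obtain \<delta> where \<delta>: "\<delta> > 0" "ball t \<delta> \<subseteq> U"
        using openE by metis
      have near: "\<bar>f r - f t\<bar> \<le> e" if "r \<in> K" "\<bar>r - t\<bar> < \<delta>" for r
      proof -
        have "r \<in> U \<inter> K" using \<delta>(2) that by (auto simp: subset_iff dist_real_def abs_minus_commute)
        then show ?thesis using U(3) by (simp add: less_imp_le)
      qed
      have "norm (F s - F t - f t * (s - t)) \<le> e * norm (s - t)"
        if s: "s \<in> X" "norm (s - t) < \<delta>" for s
      proof (cases s t rule: linorder_cases)
        case less
        have "\<bar>F t - F s - f t * (t - s)\<bar> \<le> e * (t - s)"
          by (rule key[OF s(1) tX less]) (use e s less near in auto)
        moreover have "F s - F t - f t * (s - t) = - (F t - F s - f t * (t - s))"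
          by (simp add: algebra_simps)
        ultimately show ?thesis using less by (simp only: real_norm_def abs_minus_cancel) simp
      next
        case greater
        have "\<bar>F s - F t - f t * (s - t)\<bar> \<le> e * (s - t)"
          by (rule key[OF tX s(1) greater]) (use e s greater near in auto)
        then show ?thesis using greater by simp
      qed simp
      then show ?thesis using \<delta> by metis
    qed
    then have "(F has_real_derivative f t) (at t within X)"
      unfolding has_field_derivative_def has_derivative_within_alt
      by (simp add: bounded_linear_mult_right)
    then show ?thesis
      using has_nabla_left_dense_iff[OF t de] by simp
  qed
  then show ?thesis using that by metis
qed

section \<open>Sources and closure properties of ld-continuity\<close>

lemma continuous_imp_ld:
  assumes "continuous_on X f"
  shows "ld f"
proof (rule ldI)
  have lim: "(f \<longlongrightarrow> f t) (at t within S)" if "t \<in> K" "S \<subseteq> X" for t S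
    using assms that K_subset by (auto simp: continuous_on intro: tendsto_within_subset)
  show "(f \<longlongrightarrow> f t) (at t within K)" if "t \<in> K" for t
    using lim that K_subset by blast
  show "\<exists>l. (f \<longlongrightarrow> l) (at t within K \<inter> {t<..})" if "t \<in> K" for t
    using lim[OF that, of "K \<inter> {t<..}"] K_subset by blast
qed

text \<open>From the right \<open>\<rho> s\<close> tends to \<open>t\<close>, so the right-hand
  limit of the composition is \<open>f t\<close>. At a left-scattered point this may differ from the
  value \<open>f (\<rho> t)\<close>, so the composition can be discontinuous there.\<close>

lemma continuous_rho_imp_ld:
  assumes f: "continuous_on X f"
  shows "ld (\<lambda>s. f (\<rho> s))"
proof (rule ldI)
  have lim: "((\<lambda>s. f (\<rho> s)) \<longlongrightarrow> f t) (at t within S)"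
    if "t \<in> K" "S \<subseteq> X" "(\<rho> \<longlongrightarrow> t) (at t within S)" for t S
  proof (rule continuous_within_tendsto_compose[OF _ _ that(3)])
    show "continuous (at t within X) f"
      using f that K_subset by (auto simp: continuous_on_eq_continuous_within)
    show "\<forall>\<^sub>F s in at t within S. \<rho> s \<in> X"
      using that rho_in by (intro eventually_withinI) blast
  qed
  show "((\<lambda>s. f (\<rho> s)) \<longlongrightarrow> f (\<rho> t)) (at t within K)" if "t \<in> K" "\<rho> t = t" for t
    using lim[OF that(1) K_subset] rho_tendsto_left_dense[of t] that K_subset
    by (auto intro: tendsto_within_subset)
  show "\<exists>l. ((\<lambda>s. f (\<rho> s)) \<longlongrightarrow> l) (at t within K \<inter> {t<..})" if "t \<in> K" for t
  proof -
    have "(\<rho> \<longlongrightarrow> t) (at t within K \<inter> {t<..})"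
      using rho_tendsto_right[of t] that K_subset by (auto intro: tendsto_within_subset)
    then show ?thesis
      using lim[OF that] K_subset by blast
  qed
qed

lemma ld_mult: "ld (\<lambda>s. f s * g s)" if "ld f" "ld g"
proof (rule ldI)
  show "((\<lambda>s. f s * g s) \<longlongrightarrow> f t * g t) (at t within K)" if "t \<in> K" "\<rho> t = t" for t
    using that \<open>ld f\<close> \<open>ld g\<close> by (intro tendsto_mult ld_left)
  show "\<exists>l. ((\<lambda>s. f s * g s) \<longlongrightarrow> l) (at t within K \<inter> {t<..})" if "t \<in> K" "\<sigma> t = t" for t
    using ld_right[OF \<open>ld f\<close> that] ld_right[OF \<open>ld g\<close> that] tendsto_mult by metis
qed

lemma ld_add: "ld (\<lambda>s. f s + g s)" if "ld f" "ld g"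
proof (rule ldI)
  show "((\<lambda>s. f s + g s) \<longlongrightarrow> f t + g t) (at t within K)" if "t \<in> K" "\<rho> t = t" for t
    using that \<open>ld f\<close> \<open>ld g\<close> by (intro tendsto_add ld_left)
  show "\<exists>l. ((\<lambda>s. f s + g s) \<longlongrightarrow> l) (at t within K \<inter> {t<..})" if "t \<in> K" "\<sigma> t = t" for t
    using ld_right[OF \<open>ld f\<close> that] ld_right[OF \<open>ld g\<close> that] tendsto_add by metis
qed

lemma ld_const: "ld (\<lambda>_. k)"
  by (rule continuous_imp_ld) simp

lemma ld_diff: "ld (\<lambda>s. f s - g s)" if "ld f" "ld g"
  using ld_add[OF that(1) ld_mult[OF ld_const[of "-1"] that(2)]] by simp

lemma ld_cong: "ld f" if "ld g" "\<And>s. s \<in> K \<Longrightarrow> f s = g s"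
proof (rule ldI)
  have eq: "(f \<longlongrightarrow> l) (at t within S) \<longleftrightarrow> (g \<longlongrightarrow> l) (at t within S)" if "S \<subseteq> K" for l t S
    using that \<open>\<And>s. s \<in> K \<Longrightarrow> f s = g s\<close>
    by (intro tendsto_cong eventually_withinI) blast
  show "(f \<longlongrightarrow> f t) (at t within K)" if "t \<in> K" "\<rho> t = t" for t
    using ld_left[OF \<open>ld g\<close> that] eq[of K] that \<open>\<And>s. s \<in> K \<Longrightarrow> f s = g s\<close> by simp
  show "\<exists>l. (f \<longlongrightarrow> l) (at t within K \<inter> {t<..})" if "t \<in> K" "\<sigma> t = t" for t
    using ld_right[OF \<open>ld g\<close> that] eq[of "K \<inter> {t<..}"] by (metis inf_le1)
qed

section \<open>Composition with Lagrangians and uniform estimates along a curve\<close>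

lemma ld_param_tendsto_left:
  assumes "ld_continuous_param X G" "t \<in> K" "\<rho> t = t"
    and "(x \<longlongrightarrow> x0) (at t within K)" "(w \<longlongrightarrow> w0) (at t within K)"
  shows "((\<lambda>s. G s (x s) (w s)) \<longlongrightarrow> G t x0 w0) (at t within K)"
proof -
  have "continuous (at (t, x0, w0) within X \<times> UNIV \<times> UNIV) (\<lambda>(s, x', w'). G s x' w')"
    using assms K_subset by (auto simp: ld_continuous_param_def)
  moreover have "\<forall>\<^sub>F s in at t within K. (s, x s, w s) \<in> X \<times> UNIV \<times> UNIV"
    using K_subset by (intro eventually_withinI) auto
  moreover have "((\<lambda>s. (s, x s, w s)) \<longlongrightarrow> (t, x0, w0)) (at t within K)"
    by (intro tendsto_intros assms)
  ultimately have "((\<lambda>s. case (s, x s, w s) of (s, x', w') \<Rightarrow> G s x' w') \<longlongrightarrow>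
      (case (t, x0, w0) of (s, x', w') \<Rightarrow> G s x' w')) (at t within K)"
    by (rule continuous_within_tendsto_compose)
  then show ?thesis by simp
qed

text \<open>Since \<open>s > t\<close>, the triple \<open>(s, x s, w s)\<close> never meets the
  centre, so it converges in the punctured filter and the limit of \<open>G\<close> can be composed
  with it.\<close>

lemma ld_param_tendsto_right:
  assumes "ld_continuous_param X G" "t \<in> K" "\<sigma> t = t"
    and "(x \<longlongrightarrow> x0) (at t within K \<inter> {t<..})" "(w \<longlongrightarrow> w0) (at t within K \<inter> {t<..})"
  shows "\<exists>l. ((\<lambda>s. G s (x s) (w s)) \<longlongrightarrow> l) (at t within K \<inter> {t<..})"
proof -
  let ?F = "at t within K \<inter> {t<..}"
  have "t \<in> X" using assms K_subset by blast
  then obtain l where l: "((\<lambda>(s, x', w'). G s x' w') \<longlongrightarrow> l)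
      (at (t, x0, w0) within (X \<inter> {t<..}) \<times> UNIV \<times> UNIV)"
    using assms(1,3) unfolding ld_continuous_param_def by blast
  have "((\<lambda>s. (s, x s, w s)) \<longlongrightarrow> (t, x0, w0)) ?F"
    by (intro tendsto_intros assms)
  moreover have "\<forall>\<^sub>F s in ?F. (s, x s, w s) \<in> (X \<inter> {t<..}) \<times> UNIV \<times> UNIV \<and> (s, x s, w s) \<noteq> (t, x0, w0)"
    using K_subset by (intro eventually_withinI) auto
  ultimately have "filterlim (\<lambda>s. (s, x s, w s))
      (at (t, x0, w0) within (X \<inter> {t<..}) \<times> UNIV \<times> UNIV) ?F"
    by (simp add: filterlim_at)
  from filterlim_compose[OF l this] show ?thesis by auto
qed

lemma ld_param_comp:
  assumes "ld_continuous_param X G" "ld u" "ld v"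
  shows "ld (\<lambda>s. G s (u s) (v s))"
proof (rule ldI)
  show "((\<lambda>s. G s (u s) (v s)) \<longlongrightarrow> G t (u t) (v t)) (at t within K)" if "t \<in> K" "\<rho> t = t" for t
    by (rule ld_param_tendsto_left[OF assms(1) that ld_left[OF assms(2) that] ld_left[OF assms(3) that]])
  show "\<exists>l. ((\<lambda>s. G s (u s) (v s)) \<longlongrightarrow> l) (at t within K \<inter> {t<..})" if t: "t \<in> K" "\<sigma> t = t" for t
  proof -
    obtain x0 where x0: "(u \<longlongrightarrow> x0) (at t within K \<inter> {t<..})"
      using ld_right[OF assms(2) t] .
    obtain w0 where w0: "(v \<longlongrightarrow> w0) (at t within K \<inter> {t<..})"
      using ld_right[OF assms(3) t] .
    show ?thesis
      by (rule ld_param_tendsto_right[OF assms(1) t x0 w0])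
  qed
qed

lemma regular_lagrangian_C1: "regular_lagrangian X L \<Longrightarrow> s \<in> X \<Longrightarrow> C1_plane (L s)"
  by (simp add: regular_lagrangian_def C2_plane_def)

text \<open>For \<open>L\<close> itself only the sections with fixed \<open>x\<close> and
  \<open>w\<close> are assumed ld-continuous. The parametric ld-continuity of the two partial
  derivatives makes up for this through the mean value theorem.\<close>

lemma regular_lagrangian_comp_ld:
  assumes L: "regular_lagrangian X L" and u: "ld u" and v: "ld v"
  shows "ld (\<lambda>s. L s (u s) (v s))"
proof (rule ldI)
  have p: "ld_continuous_param X (\<lambda>s. pd1 (L s))" "ld_continuous_param X (\<lambda>s. pd2 (L s))"
    and sect: "\<And>x w. ld_continuous_on X X (\<lambda>s. L s x w)"
    using L by (auto simp: regular_lagrangian_def)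
  have C1: "\<forall>\<^sub>F s in at t within S. C1_plane (L s)" if "S \<subseteq> X" for t S
    using that regular_lagrangian_C1[OF L] by (intro eventually_withinI) blast
  show "((\<lambda>s. L s (u s) (v s)) \<longlongrightarrow> L t (u t) (v t)) (at t within K)" if t: "t \<in> K" "\<rho> t = t" for t
  proof (rule C1_plane_family_tendsto[OF C1[OF K_subset] ld_left[OF u t] ld_left[OF v t]])
    have "((\<lambda>s. L s (u t) (v t)) \<longlongrightarrow> L t (u t) (v t)) (at t within X)"
      using sect t K_subset by (auto simp: ld_continuous_on_def continuous_within)
    then show "((\<lambda>s. L s (u t) (v t)) \<longlongrightarrow> L t (u t) (v t)) (at t within K)"
      using K_subset by (rule tendsto_within_subset)
  qed (use ld_param_tendsto_left[OF p(1) t] ld_param_tendsto_left[OF p(2) t] in blast)+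
  show "\<exists>l. ((\<lambda>s. L s (u s) (v s)) \<longlongrightarrow> l) (at t within K \<inter> {t<..})" if t: "t \<in> K" "\<sigma> t = t" for t
  proof -
    obtain x0 where x0: "(u \<longlongrightarrow> x0) (at t within K \<inter> {t<..})"
      using ld_right[OF u t] .
    obtain w0 where w0: "(v \<longlongrightarrow> w0) (at t within K \<inter> {t<..})"
      using ld_right[OF v t] .
    obtain l where l: "((\<lambda>s. L s x0 w0) \<longlongrightarrow> l) (at t within X \<inter> {t<..})"
      using sect t K_subset unfolding ld_continuous_on_def by blast
    have sub: "K \<inter> {t<..} \<subseteq> X \<inter> {t<..}" "K \<inter> {t<..} \<subseteq> X" using K_subset by auto
    have "((\<lambda>s. L s (u s) (v s)) \<longlongrightarrow> l) (at t within K \<inter> {t<..})"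
      by (rule C1_plane_family_tendsto[OF C1[OF sub(2)] x0 w0 tendsto_within_subset[OF l sub(1)]])
        (use ld_param_tendsto_right[OF p(1) t] ld_param_tendsto_right[OF p(2) t] in blast)+
    then show ?thesis by blast
  qed
qed

text \<open>One radius \<open>r\<close> for all \<open>s\<close>, even though \<open>u\<close> and
  \<open>v\<close> may jump. Near a dense point the parametric limit of \<open>G\<close> yields a
  radius, at a single \<open>s\<close> the continuity of \<open>G s\<close> in the plane does, and
  finitely many radii have a positive minimum.\<close>

lemma ld_param_equicontinuous:
  assumes G: "ld_continuous_param X G"
    and cont: "\<And>s. s \<in> X \<Longrightarrow> continuous_on UNIV (\<lambda>(x, w). G s x w)"
    and u: "ld u" and v: "ld v" and e: "e > 0"
  obtains r where "r > 0" "\<And>s x w. s \<in> K \<Longrightarrow> \<bar>x - u s\<bar> < r \<Longrightarrow> \<bar>w - v s\<bar> < r \<Longrightarrow>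
    \<bar>G s x w - G s (u s) (v s)\<bar> \<le> e"
proof -
  define P where "P = (\<lambda>S. \<exists>r>0. \<forall>s\<in>S. \<forall>x w. \<bar>x - u s\<bar> < r \<longrightarrow> \<bar>w - v s\<bar> < r \<longrightarrow>
    \<bar>G s x w - G s (u s) (v s)\<bar> \<le> e)"
  have e2: "e / 2 > 0" using e by simp
  have "P K"
  proof (rule local_to_global)
    show "P {}" unfolding P_def using zero_less_one by blast
    show "P S'" if "P S" "S' \<subseteq> S" for S S'
      using that unfolding P_def by blast
    show "P (S1 \<union> S2)" if P12: "P S1" "P S2" for S1 S2
    proof -
      obtain r1 r2 where "r1 > 0" "r2 > 0"
        "\<forall>s\<in>S1. \<forall>x w. \<bar>x - u s\<bar> < r1 \<longrightarrow> \<bar>w - v s\<bar> < r1 \<longrightarrow> \<bar>G s x w - G s (u s) (v s)\<bar> \<le> e"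
        "\<forall>s\<in>S2. \<forall>x w. \<bar>x - u s\<bar> < r2 \<longrightarrow> \<bar>w - v s\<bar> < r2 \<longrightarrow> \<bar>G s x w - G s (u s) (v s)\<bar> \<le> e"
        using P12 unfolding P_def by blast
      then show ?thesis
        unfolding P_def by (intro exI[of _ "min r1 r2"]) auto
    qed
    show "P {t}" if t: "t \<in> K" for t
    proof -
      have "((\<lambda>(x, w). G t x w) \<longlongrightarrow> G t (u t) (v t)) (at (u t, v t))"
        using cont[of t] t K_subset by (auto simp: continuous_on)
      from tendstoD[OF this e2] obtain \<delta> where \<delta>: "\<delta> > 0"
        "\<And>q. q \<noteq> (u t, v t) \<Longrightarrow> dist q (u t, v t) < \<delta> \<Longrightarrow>
          dist (case q of (x, w) \<Rightarrow> G t x w) (G t (u t) (v t)) < e / 2"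
        unfolding eventually_at by (metis UNIV_I)
      show ?thesis
        unfolding P_def
      proof (rule uniform_box)
        show "\<delta> / 2 > 0" using \<delta> by simp
        fix s x w assume s: "s \<in> {t}" and near: "\<bar>x - u t\<bar> < \<delta> / 2" "\<bar>w - v t\<bar> < \<delta> / 2"
        have "dist (x, w) (u t, v t) < \<delta>"
          using dist_triple_le[of 0 x w 0 "u t" "v t"] near by (simp add: dist_Pair_Pair)
        then show "\<bar>G s x w - G t (u t) (v t)\<bar> < e / 2"
          using \<delta>(2)[of "(x, w)"] s e by (cases "(x, w) = (u t, v t)") (auto simp: dist_real_def)
      qed (use \<delta> in auto)
    qed
    show "\<exists>U. open U \<and> t \<in> U \<and> P (U \<inter> K)" if t: "t \<in> K" "\<rho> t = t" for t
    proof -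
      have "((\<lambda>(s, x, w). G s x w) \<longlongrightarrow> G t (u t) (v t)) (at (t, u t, v t) within X \<times> UNIV \<times> UNIV)"
        using G t K_subset by (auto simp: ld_continuous_param_def continuous_within)
      then obtain \<eta> where \<eta>: "\<eta> > 0" "\<And>s x w. s \<in> X \<Longrightarrow> \<bar>s - t\<bar> < \<eta> \<Longrightarrow> \<bar>x - u t\<bar> < \<eta> \<Longrightarrow>
          \<bar>w - v t\<bar> < \<eta> \<Longrightarrow> \<bar>G s x w - G t (u t) (v t)\<bar> < e / 2"
        by (rule tendsto_triple_box[OF _ _ e2]) auto
      have "\<eta> / 2 > 0" using \<eta> by simp
      then obtain U V where U: "open U" "t \<in> U" "\<forall>s\<in>U \<inter> K. \<bar>u s - u t\<bar> < \<eta> / 2"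
        and V: "open V" "t \<in> V" "\<forall>s\<in>V \<inter> K. \<bar>v s - v t\<bar> < \<eta> / 2"
        using ld_locally_left[OF u t, of "\<eta> / 2"] ld_locally_left[OF v t, of "\<eta> / 2"] by blast
      have "P ((U \<inter> V \<inter> ball t \<eta>) \<inter> K)"
        unfolding P_def
      proof (rule uniform_box[OF \<eta>(1), where ?x0.0 = "u t" and ?w0.0 = "v t" and l = "G t (u t) (v t)"])
        fix s x w assume s: "s \<in> (U \<inter> V \<inter> ball t \<eta>) \<inter> K" and xw: "\<bar>x - u t\<bar> < \<eta>" "\<bar>w - v t\<bar> < \<eta>"
        show "\<bar>G s x w - G t (u t) (v t)\<bar> < e / 2"
          by (rule \<eta>(2)[OF _ _ xw]) (use s K_subset in \<open>auto simp: dist_real_def abs_minus_commute\<close>)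
      qed (use U V in auto)
      then show ?thesis
        using U V \<eta> by (intro exI[of _ "U \<inter> V \<inter> ball t \<eta>"]) auto
    qed
    show "\<exists>U. open U \<and> t \<in> U \<and> P (U \<inter> (K \<inter> {t<..}))" if t: "t \<in> K" "\<sigma> t = t" for t
    proof -
      \<comment> \<open>The reference point consists of the right-hand limits of \<open>u\<close>
        and \<open>v\<close>, which need not be their values at \<open>t\<close>.\<close>
      obtain x0 w0 where x0: "\<And>e. e > 0 \<Longrightarrow> \<exists>U. open U \<and> t \<in> U \<and> (\<forall>s\<in>U \<inter> (K \<inter> {t<..}). \<bar>u s - x0\<bar> < e)"
        and w0: "\<And>e. e > 0 \<Longrightarrow> \<exists>U. open U \<and> t \<in> U \<and> (\<forall>s\<in>U \<inter> (K \<inter> {t<..}). \<bar>v s - w0\<bar> < e)"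
        using ld_locally_right[OF u t] ld_locally_right[OF v t] by metis
      have "t \<in> X" using t K_subset by blast
      then obtain l where l: "((\<lambda>(s, x, w). G s x w) \<longlongrightarrow> l)
          (at (t, x0, w0) within (X \<inter> {t<..}) \<times> UNIV \<times> UNIV)"
        using G t(2) unfolding ld_continuous_param_def by blast
      then obtain \<eta> where \<eta>: "\<eta> > 0" "\<And>s x w. s \<in> X \<inter> {t<..} \<Longrightarrow> \<bar>s - t\<bar> < \<eta> \<Longrightarrow> \<bar>x - x0\<bar> < \<eta> \<Longrightarrow>
          \<bar>w - w0\<bar> < \<eta> \<Longrightarrow> \<bar>G s x w - l\<bar> < e / 2"
        by (rule tendsto_triple_box[OF _ _ e2]) auto
      have "\<eta> / 2 > 0" using \<eta> by simp
      then obtain U V where U: "open U" "t \<in> U" "\<forall>s\<in>U \<inter> (K \<inter> {t<..}). \<bar>u s - x0\<bar> < \<eta> / 2"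
        and V: "open V" "t \<in> V" "\<forall>s\<in>V \<inter> (K \<inter> {t<..}). \<bar>v s - w0\<bar> < \<eta> / 2"
        using x0[of "\<eta> / 2"] w0[of "\<eta> / 2"] by blast
      have "P ((U \<inter> V \<inter> ball t \<eta>) \<inter> (K \<inter> {t<..}))"
        unfolding P_def
      proof (rule uniform_box[OF \<eta>(1), where ?x0.0 = x0 and ?w0.0 = w0 and l = l])
        fix s x w assume s: "s \<in> (U \<inter> V \<inter> ball t \<eta>) \<inter> (K \<inter> {t<..})" and xw: "\<bar>x - x0\<bar> < \<eta>" "\<bar>w - w0\<bar> < \<eta>"
        show "\<bar>G s x w - l\<bar> < e / 2"
          by (rule \<eta>(2)[OF _ _ xw]) (use s K_subset in \<open>auto simp: dist_real_def abs_minus_commute\<close>)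
      qed (use U V in auto)
      then show ?thesis
        using U V \<eta> by (intro exI[of _ "U \<inter> V \<inter> ball t \<eta>"]) auto
    qed
  qed
  then show ?thesis
    using that unfolding P_def by blast
qed

section \<open>The first variation\<close>

text \<open>The mean value theorem gives partial derivatives at intermediate points, and
  equicontinuity moves them back to \<open>(u s, v s)\<close>. The error
  \<open>\<epsilon> * e\<close> is uniform in \<open>s\<close>, so the inequality can be integrated;
  this replaces differentiation under the integral.\<close>

lemma lagrangian_first_order_bound:
  assumes L: "regular_lagrangian X L" and u: "ld u" and v: "ld v"
    and M: "M > 0" "\<And>s. s \<in> K \<Longrightarrow> \<bar>a s\<bar> \<le> M" "\<And>s. s \<in> K \<Longrightarrow> \<bar>b s\<bar> \<le> M" and e: "e > 0"
  obtains \<epsilon>0 where "\<epsilon>0 > 0" "\<And>\<epsilon> s. 0 < \<epsilon> \<Longrightarrow> \<epsilon> < \<epsilon>0 \<Longrightarrow> s \<in> K \<Longrightarrow>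
    L s (u s + \<epsilon> * a s) (v s + \<epsilon> * b s) \<le> L s (u s) (v s) +
      \<epsilon> * (pd1 (L s) (u s) (v s) * a s + pd2 (L s) (u s) (v s) * b s) + \<epsilon> * e"
proof -
  have p: "ld_continuous_param X (\<lambda>s. pd1 (L s))" "ld_continuous_param X (\<lambda>s. pd2 (L s))"
    using L by (auto simp: regular_lagrangian_def)
  have cont: "continuous_on UNIV (\<lambda>(x, w). pd1 (L s) x w)" "continuous_on UNIV (\<lambda>(x, w). pd2 (L s) x w)"
    if "s \<in> X" for s
    using regular_lagrangian_C1[OF L that] by (auto simp: C1_plane_def)
  \<comment> \<open>Each partial derivative contributes at most
    \<open>e' * (\<epsilon> * M)\<close>, which is half of the error
    \<open>\<epsilon> * e\<close>.\<close>
  define e' where "e' = e / (2 * M)"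
  have e': "e' > 0" "e' * M = e / 2" using e M(1) by (auto simp: e'_def)
  obtain r1 where r1: "r1 > 0" "\<And>s x w. s \<in> K \<Longrightarrow> \<bar>x - u s\<bar> < r1 \<Longrightarrow> \<bar>w - v s\<bar> < r1 \<Longrightarrow>
      \<bar>pd1 (L s) x w - pd1 (L s) (u s) (v s)\<bar> \<le> e'"
    using ld_param_equicontinuous[OF p(1) cont(1) u v e'(1)] by metis
  obtain r2 where r2: "r2 > 0" "\<And>s x w. s \<in> K \<Longrightarrow> \<bar>x - u s\<bar> < r2 \<Longrightarrow> \<bar>w - v s\<bar> < r2 \<Longrightarrow>
      \<bar>pd2 (L s) x w - pd2 (L s) (u s) (v s)\<bar> \<le> e'"
    using ld_param_equicontinuous[OF p(2) cont(2) u v e'(1)] by metis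
  show ?thesis
  \<comment> \<open>Below this bound both displacements, of size at most
    \<open>\<epsilon> * M\<close>, stay within the radii \<open>r1\<close> and
    \<open>r2\<close>.\<close>
  proof (rule that[of "min r1 r2 / M"])
    show "min r1 r2 / M > 0" using r1 r2 M by simp
    fix \<epsilon> s assume eps: "0 < \<epsilon>" "\<epsilon> < min r1 r2 / M" and s: "s \<in> K"
    have epsM: "\<epsilon> * M < r1" "\<epsilon> * M < r2"
      using eps M(1) by (auto simp: pos_less_divide_eq)
    have le: "\<bar>\<epsilon> * a s\<bar> \<le> \<epsilon> * M" "\<bar>\<epsilon> * b s\<bar> \<le> \<epsilon> * M"
      using M(2,3)[OF s] eps by (auto simp: abs_mult)
    obtain \<xi> \<zeta> where \<xi>: "\<bar>\<xi> - u s\<bar> \<le> \<bar>u s + \<epsilon> * a s - u s\<bar>"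
      and \<zeta>: "\<bar>\<zeta> - v s\<bar> \<le> \<bar>v s + \<epsilon> * b s - v s\<bar>"
      and eq: "L s (u s + \<epsilon> * a s) (v s + \<epsilon> * b s) = L s (u s) (v s) +
        pd1 (L s) \<xi> (v s + \<epsilon> * b s) * (u s + \<epsilon> * a s - u s) +
        pd2 (L s) (u s) \<zeta> * (v s + \<epsilon> * b s - v s)"
      using C1_plane_increment[of "L s" "u s" "u s + \<epsilon> * a s" "v s" "v s + \<epsilon> * b s"]
        regular_lagrangian_C1[OF L, of s] s K_subset by blast
    have bound: "q * z \<le> q0 * z + \<epsilon> * (e / 2)" if "\<bar>q - q0\<bar> \<le> e'" "\<bar>z\<bar> \<le> \<epsilon> * M" for q q0 z
    proof -
      have "\<bar>(q - q0) * z\<bar> \<le> e' * (\<epsilon> * M)"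
        unfolding abs_mult using that e' by (intro mult_mono) auto
      also have "\<dots> = \<epsilon> * (e' * M)" by simp
      finally have "(q - q0) * z \<le> \<epsilon> * (e / 2)" using e' by simp
      then show ?thesis by (simp add: left_diff_distrib)
    qed
    have "pd1 (L s) \<xi> (v s + \<epsilon> * b s) * (\<epsilon> * a s) \<le> pd1 (L s) (u s) (v s) * (\<epsilon> * a s) + \<epsilon> * (e / 2)"
      by (rule bound[OF r1(2)[OF s] le(1)]) (use \<xi> le epsM in auto)
    moreover have "pd2 (L s) (u s) \<zeta> * (\<epsilon> * b s) \<le> pd2 (L s) (u s) (v s) * (\<epsilon> * b s) + \<epsilon> * (e / 2)"
      by (rule bound[OF r2(2)[OF s] le(2)]) (use \<zeta> le epsM r2 in auto)
    ultimately show "L s (u s + \<epsilon> * a s) (v s + \<epsilon> * b s) \<le> L s (u s) (v s) +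
        \<epsilon> * (pd1 (L s) (u s) (v s) * a s + pd2 (L s) (u s) (v s) * b s) + \<epsilon> * e"
      unfolding eq by (simp add: algebra_simps)
  qed
qed

text \<open>\<open>J d - J c\<close> is the first variation in the direction \<eta>. Comparing the
  action at \<open>y0\<close> and at \<open>y0 + \<epsilon> * \<eta>\<close> for small positive
  \<epsilon> gives its sign.\<close>

lemma weak_local_min_first_variation:
  assumes L: "regular_lagrangian X L" and min: "weak_local_min T c d L A B y0"
    and \<eta>: "\<And>t. t \<in> K \<Longrightarrow> has_nabla_derivative X \<eta> (b t) t" and b: "ld b"
    and bc: "\<eta> c = 0" "\<eta> d = 0"
    and J: "\<And>t. t \<in> K \<Longrightarrow> has_nabla_derivative X J
      (pd1 (L t) (y0 (\<rho> t)) (nabla_deriv X y0 t) * \<eta> (\<rho> t) +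
       pd2 (L t) (y0 (\<rho> t)) (nabla_deriv X y0 t) * b t) t"
  shows "J c \<le> J d"
proof -
  define u v where "u = (\<lambda>s. y0 (\<rho> s))" and "v = nabla_deriv X y0"
  have y0: "has_nabla_derivative X y0 (v t) t" if "t \<in> K" for t
    using min that nabla_deriv_eq unfolding weak_local_min_def C1_ld_def v_def by blast
  have v: "ld v"
    using min by (simp add: weak_local_min_def C1_ld_def v_def)
  have u: "ld u"
    unfolding u_def by (rule continuous_rho_imp_ld[OF antiderivative_continuous_on[OF y0]])
  have a: "ld (\<lambda>s. \<eta> (\<rho> s))"
    by (rule continuous_rho_imp_ld[OF antiderivative_continuous_on[OF \<eta>]])
  obtain \<delta> where \<delta>: "\<delta> > 0" and opt: "\<And>y. y \<in> C1_ld T c d \<Longrightarrow> y c = A \<Longrightarrow> y d = B \<Longrightarrow>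
      C1_ld_norm T c d (\<lambda>t. y t - y0 t) \<le> \<delta> \<Longrightarrow> action T c d L y0 \<le> action T c d L y"
    using min unfolding weak_local_min_def by blast
  obtain Ma where Ma: "Ma > 0" "\<And>s. s \<in> K \<Longrightarrow> \<bar>\<eta> (\<rho> s)\<bar> \<le> Ma" using ld_bounded[OF a] by blast
  obtain Mb where Mb: "Mb > 0" "\<And>s. s \<in> K \<Longrightarrow> \<bar>b s\<bar> \<le> Mb" using ld_bounded[OF b] by blast
  define M where "M = max Ma Mb"
  have M: "M > 0" "\<And>s. s \<in> K \<Longrightarrow> \<bar>\<eta> (\<rho> s)\<bar> \<le> M" "\<And>s. s \<in> K \<Longrightarrow> \<bar>b s\<bar> \<le> M"
    using Ma Mb by (auto simp: M_def le_max_iff_disj)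
  obtain H0 where H0: "\<And>t. t \<in> K \<Longrightarrow> has_nabla_derivative X H0 (L t (u t) (v t)) t"
    using ld_antiderivative[OF regular_lagrangian_comp_ld[OF L u v]] by blast
  have action0: "action T c d L y0 = H0 d - H0 c"
    unfolding action_def using H0 by (intro nabla_integral_eq) (simp add: u_def v_def)
  have approx: "0 \<le> J d - J c + e * (d - c)" if e: "e > 0" for e
  proof -
    obtain \<epsilon>0 where \<epsilon>0: "\<epsilon>0 > 0" and le: "\<And>\<epsilon> s. 0 < \<epsilon> \<Longrightarrow> \<epsilon> < \<epsilon>0 \<Longrightarrow> s \<in> K \<Longrightarrow>
        L s (u s + \<epsilon> * \<eta> (\<rho> s)) (v s + \<epsilon> * b s) \<le> L s (u s) (v s) +
        \<epsilon> * (pd1 (L s) (u s) (v s) * \<eta> (\<rho> s) + pd2 (L s) (u s) (v s) * b s) + \<epsilon> * e"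
      using lagrangian_first_order_bound[where a = "\<lambda>s. \<eta> (\<rho> s)" and b = b, OF L u v M e] by metis
    \<comment> \<open>The first term makes the first-order bound applicable; the second keeps each
      of the two suprema in the norm at most \<open>\<delta> / 2\<close>.\<close>
    define \<epsilon> where "\<epsilon> = min (\<epsilon>0 / 2) (\<delta> / (2 * M))"
    have eps: "0 < \<epsilon>" "\<epsilon> < \<epsilon>0" "\<epsilon> \<le> \<delta> / (2 * M)" using \<epsilon>0 \<delta> M(1) by (auto simp: \<epsilon>_def)
    then have epsM: "\<epsilon> * M \<le> \<delta> / 2" using M(1) by (simp add: field_simps)
    define y where "y = (\<lambda>t. y0 t + \<epsilon> * \<eta> t)"
    have y: "has_nabla_derivative X y (v t + \<epsilon> * b t) t" if "t \<in> K" for t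
      unfolding y_def using that by (intro has_nabla_add has_nabla_cmult y0 \<eta>)
    have "ld (nabla_deriv X y)"
      by (rule ld_cong[OF ld_add[OF v ld_mult[OF ld_const[of \<epsilon>] b]]]) (rule nabla_deriv_eq[OF y])
    then have yC1: "y \<in> C1_ld T c d"
      using y by (auto simp: C1_ld_def)
    have dy: "nabla_deriv X (\<lambda>t. y t - y0 t) t = \<epsilon> * b t" if "t \<in> K" for t
      using has_nabla_cmult[OF \<eta>[OF that], of \<epsilon>] by (simp add: y_def nabla_deriv_eq)
    have small: "\<bar>\<epsilon> * z\<bar> \<le> \<delta> / 2" if "\<bar>z\<bar> \<le> M" for z
    proof -
      have "\<bar>\<epsilon> * z\<bar> \<le> \<epsilon> * M" using that eps by (simp add: abs_mult)
      then show ?thesis using epsM by simp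
    qed
    have "K \<noteq> {}" using dK by blast
    then have "(SUP t\<in>K. \<bar>y (\<rho> t) - y0 (\<rho> t)\<bar>) \<le> \<delta> / 2"
      by (rule cSUP_least) (use small M(2) in \<open>simp add: y_def\<close>)
    moreover have "(SUP t\<in>K. \<bar>nabla_deriv X (\<lambda>t. y t - y0 t) t\<bar>) \<le> \<delta> / 2"
      using \<open>K \<noteq> {}\<close> by (rule cSUP_least) (use small M(3) dy in simp)
    ultimately have "C1_ld_norm T c d (\<lambda>t. y t - y0 t) \<le> \<delta>"
      by (simp add: C1_ld_norm_def)
    then have opt_y: "action T c d L y0 \<le> action T c d L y"
      using min bc by (intro opt yC1) (auto simp: y_def weak_local_min_def)
    have "ld (\<lambda>s. L s (u s + \<epsilon> * \<eta> (\<rho> s)) (v s + \<epsilon> * b s))"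
      by (intro regular_lagrangian_comp_ld[OF L] ld_add ld_mult ld_const a b u v)
    then obtain H where H: "\<And>t. t \<in> K \<Longrightarrow>
        has_nabla_derivative X H (L t (u t + \<epsilon> * \<eta> (\<rho> t)) (v t + \<epsilon> * b t)) t"
      using ld_antiderivative by blast
    have "action T c d L y = H d - H c"
      unfolding action_def using H
      by (intro nabla_integral_eq) (simp add: nabla_deriv_eq[OF y], simp add: y_def u_def)
    then have "H0 d - H0 c \<le> H d - H c"
      using opt_y action0 by simp
    \<comment> \<open>The right-hand side is the increment of an antiderivative of the first-order
      bound, \<open>\<epsilon> * e * t\<close> accounting for the constant error.\<close>
    also have "H d - H c \<le> (H0 d + \<epsilon> * J d + \<epsilon> * e * d) - (H0 c + \<epsilon> * J c + \<epsilon> * e * c)"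
    proof (rule nabla_le_imp_increment_le[OF H])
      show "has_nabla_derivative X (\<lambda>t. H0 t + \<epsilon> * J t + \<epsilon> * e * t)
          (L t (u t) (v t) + \<epsilon> * (pd1 (L t) (u t) (v t) * \<eta> (\<rho> t) + pd2 (L t) (u t) (v t) * b t) +
           \<epsilon> * e * 1) t" if "t \<in> K" for t
        using that J[OF that] unfolding u_def[symmetric] v_def[symmetric]
        by (intro has_nabla_add has_nabla_cmult has_nabla_ident H0) (simp_all add: u_def)
    qed (use le eps in simp_all)
    finally have "0 \<le> \<epsilon> * (J d - J c + e * (d - c))"
      by (simp add: algebra_simps)
    then show ?thesis
      using eps by (simp add: zero_le_mult_iff)
  qed
  \<comment> \<open>The slack is rescaled by the length of the segment before it is sent to
    0.\<close>
  have "J c \<le> J d + e" if "e > 0" for e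
    using approx[of "e / (d - c)"] that cd by simp
  then show ?thesis
    by (rule field_le_epsilon)
qed

lemma weak_local_min_euler_lagrange:
  assumes L: "regular_lagrangian X L" and min: "weak_local_min T c d L A B y0"
  shows "\<exists>p. (\<forall>s\<in>K. p s = pd2 (L s) (y0 (\<rho> s)) (nabla_deriv X y0 s)) \<and>
    (\<forall>s\<in>K. has_nabla_derivative X p (pd1 (L s) (y0 (\<rho> s)) (nabla_deriv X y0 s)) s)"
proof -
  define f1 f2 where "f1 = (\<lambda>s. pd1 (L s) (y0 (\<rho> s)) (nabla_deriv X y0 s))"
    and "f2 = (\<lambda>s. pd2 (L s) (y0 (\<rho> s)) (nabla_deriv X y0 s))"
  have y0: "has_nabla_derivative X y0 (nabla_deriv X y0 t) t" if "t \<in> K" for t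
    using min that nabla_deriv_eq unfolding weak_local_min_def C1_ld_def by blast
  have v: "ld (nabla_deriv X y0)"
    using min by (simp add: weak_local_min_def C1_ld_def)
  have u: "ld (\<lambda>s. y0 (\<rho> s))"
    by (rule continuous_rho_imp_ld[OF antiderivative_continuous_on[OF y0]])
  have f: "ld f1" "ld f2"
    using L ld_param_comp[OF _ u v] by (auto simp: f1_def f2_def regular_lagrangian_def)
  obtain P where P: "\<And>t. t \<in> K \<Longrightarrow> has_nabla_derivative X P (f1 t) t"
    using ld_antiderivative[OF f(1)] by blast
  define q where "q = (\<lambda>s. f2 s - P s)"
  have q: "ld q"
    unfolding q_def by (rule ld_diff[OF f(2) continuous_imp_ld[OF antiderivative_continuous_on[OF P]]])
  obtain Q where Q: "\<And>t. t \<in> K \<Longrightarrow> has_nabla_derivative X Q (q t) t"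
    using ld_antiderivative[OF q] by blast
  define m where "m = (Q d - Q c) / (d - c)"
  have mdc: "m * (d - c) = Q d - Q c" using cd by (simp add: m_def)
  have "ld (\<lambda>s. (q s - m) * (q s - m))"
    by (intro ld_mult ld_diff q ld_const)
  then obtain W where W: "\<And>t. t \<in> K \<Longrightarrow> has_nabla_derivative X W ((q t - m) * (q t - m)) t"
    using ld_antiderivative by blast
  \<comment> \<open>The additive constant normalises the value at \<open>c\<close>; the mean value
    \<open>m\<close> as slope is what makes the value at \<open>d\<close> vanish too.\<close>
  define \<eta> where "\<eta> = (\<lambda>t. m * t - Q t - (m * c - Q c))"
  have \<eta>: "has_nabla_derivative X \<eta> (m - q t) t" if "t \<in> K" for t
    using has_nabla_diff[OF has_nabla_diff[OF has_nabla_cmult[OF has_nabla_ident] Q] has_nabla_const, of t m] that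
    by (simp add: \<eta>_def)
  have bc: "\<eta> c = 0" "\<eta> d = 0"
    using mdc by (auto simp: \<eta>_def algebra_simps)
  \<comment> \<open>Since \<open>f2 = P + q\<close>, the first variation has the part
    \<open>P^nabla * \<eta> (\<rho> t) + P * \<eta>^nabla\<close>, the derivative of
    \<open>P * \<eta>\<close>, and the remainder
    \<open>q * (m - q) = m * (m - q) - (q - m)^2\<close>.\<close>
  define J where "J = (\<lambda>t. P t * \<eta> t + m * \<eta> t - W t)"
  have J: "has_nabla_derivative X J (f1 t * \<eta> (\<rho> t) + f2 t * (m - q t)) t" if "t \<in> K" for t
  proof -
    have "has_nabla_derivative X J
        (f1 t * \<eta> (\<rho> t) + P t * (m - q t) + m * (m - q t) - (q t - m) * (q t - m)) t"
      unfolding J_def using that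
      by (intro has_nabla_diff has_nabla_add has_nabla_mult has_nabla_cmult P \<eta> W)
    moreover have "f1 t * \<eta> (\<rho> t) + P t * (m - q t) + m * (m - q t) - (q t - m) * (q t - m) =
        f1 t * \<eta> (\<rho> t) + f2 t * (m - q t)"
      by (simp add: q_def algebra_simps)
    ultimately show ?thesis by simp
  qed
  have "J c \<le> J d"
    using J by (intro weak_local_min_first_variation[OF L min \<eta> _ bc])
      (auto simp: f1_def f2_def intro: ld_diff ld_const q)
  then have Wdc: "W d \<le> W c"
    by (simp add: J_def bc)
  have W_mono: "W s \<le> W t" if "s \<in> X" "t \<in> X" "s \<le> t" for s t
    using that by (intro nabla_nonneg_imp_mono[OF W]) auto
  have W_const: "W t = W c" if "t \<in> X" for t
    using W_mono[of c t] W_mono[of t d] Wdc that X_bounds[OF that] by simp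
  \<comment> \<open>At each point of \<open>K\<close> the square and 0 are both nabla derivatives of
    \<open>W\<close>, and uniqueness identifies them.\<close>
  have q_eq: "q t = m" if "t \<in> K" for t
    using has_nabla_unique[OF W[OF that] has_nabla_const_on[OF that W_const]] by simp
  have "P t + m = f2 t" if "t \<in> K" for t
    using q_eq[OF that] by (simp add: q_def)
  moreover have "has_nabla_derivative X (\<lambda>s. P s + m) (f1 t) t" if "t \<in> K" for t
    using has_nabla_add[OF P[OF that] has_nabla_const[OF that]] by simp
  \<comment> \<open>\<open>P + m\<close> is defined on all of \<open>X\<close>, so it also provides
    the value at a right-scattered \<open>c\<close>, where the formula for \<open>L_w\<close> along
    \<open>y0\<close> prescribes none.\<close>
  ultimately show ?thesis
    by (intro exI[of _ "\<lambda>s. P s + m"]) (simp add: f1_def f2_def)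
qed

end

theorem theorem6p10:
  fixes T :: "real set" and c d A B :: real
    and L :: "real \<Rightarrow> real \<Rightarrow> real \<Rightarrow> real" and y0 :: "real \<Rightarrow> real"
  assumes "time_scale T" and "c \<in> T" and "d \<in> T" and "c < d"
    and "regular_lagrangian (ts_Icc T c d) L"
    and "weak_local_min T c d L A B y0"
  shows "\<exists>p.
    (\<forall>s\<in>ts_Icc_kappa T c d.
       p s = pd2 (L s) (y0 (ts_rho (ts_Icc T c d) s)) (nabla_deriv (ts_Icc T c d) y0 s)) \<and>
    (\<forall>s\<in>ts_Icc_kappa T c d.
       has_nabla_derivative (ts_Icc T c d) p
         (pd1 (L s) (y0 (ts_rho (ts_Icc T c d) s)) (nabla_deriv (ts_Icc T c d) y0 s)) s)"
proof -
  interpret ts_segment T c d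
    using assms by unfold_locales
  show ?thesis
    using assms by (intro weak_local_min_euler_lagrange)
qed

end
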